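(* $\mathrm{LPO}$ implies $\mathrm{DL}(1,\infty)$ (constructively, i.e. in BISH).
   Context: The paper works constructively, in Bishop's informal constructive mathematics (BISH, with the principle of dependent choices); implications are to be proved without the principle of excluded middle. $\mathrm{LPO}$ (limited principle of omniscience) is the statement: for every $\alpha:\mathbb{N}\to\{0,1\}$, either there exists $n\in\mathbb{N}$ with $\alpha(n)=1$, or $\alpha(n)=0$ for all $n\in\mathbb{N}$. $\mathrm{DL}(1,\infty)$ is the statement: for every $\alpha:\mathbb{N}\to\mathbb{N}$ there is an infinite set of indices $\{i_1<i_2<i_3<\cdots\}\subseteq\mathbb{N}$ (given as a strictly increasing sequence) such that $\alpha(i)\le\alpha(j)$ for all $i<j$ in this set, i.e. $\alpha(i_1)\le\alpha(i_2)\le\alpha(i_3)\le\cdots$. *)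

theory Defs
  imports Main
begin

text \<open>
  HOL is classical, so LPO is a theorem of HOL and the HOL implication from LPO to any true
  statement has no content. The claim concerns provability in constructive mathematics; it is
  therefore expressed by derivability in a formal system for BISH. The system is
  \<^emph>\<open>E-HA\<close> in all finite types (intuitionistic arithmetic in finite types with products, primitive
  recursion in all types and extensional equality), extended by the schema of dependent choices
  at every type. There is no excluded middle, no double negation rule and no Markov principle.
\<close>

datatype ty = Nat | Fun ty ty (infixr "\<^bold>\<Rightarrow>" 70) | Prod ty ty (infixr "\<^bold>\<times>" 75)

text \<open>A variable is a name together with its type, so no typing contexts are needed.\<close>

type_synonym var = "string \<times> ty"

datatype tm =
    Var var
  | Lam var tm
  | App tm tm (infixl "\<^bold>\<cdot>" 90)
  | Zero
  | Succ tm
  | Rec tm tm tm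
  | Pair tm tm
  | Fst tm
  | Snd tm

inductive has_type :: "tm \<Rightarrow> ty \<Rightarrow> bool" (infix "\<^bold>:" 50) where
  "Var x \<^bold>: snd x"
| "t \<^bold>: \<tau> \<Longrightarrow> Lam x t \<^bold>: snd x \<^bold>\<Rightarrow> \<tau>"
| "s \<^bold>: \<sigma> \<^bold>\<Rightarrow> \<tau> \<Longrightarrow> t \<^bold>: \<sigma> \<Longrightarrow> s \<^bold>\<cdot> t \<^bold>: \<tau>"
| "Zero \<^bold>: Nat"
| "t \<^bold>: Nat \<Longrightarrow> Succ t \<^bold>: Nat"
| "a \<^bold>: \<tau> \<Longrightarrow> b \<^bold>: Nat \<^bold>\<Rightarrow> \<tau> \<^bold>\<Rightarrow> \<tau> \<Longrightarrow> t \<^bold>: Nat \<Longrightarrow> Rec a b t \<^bold>: \<tau>"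
| "s \<^bold>: \<sigma> \<Longrightarrow> t \<^bold>: \<tau> \<Longrightarrow> Pair s t \<^bold>: \<sigma> \<^bold>\<times> \<tau>"
| "t \<^bold>: \<sigma> \<^bold>\<times> \<tau> \<Longrightarrow> Fst t \<^bold>: \<sigma>"
| "t \<^bold>: \<sigma> \<^bold>\<times> \<tau> \<Longrightarrow> Snd t \<^bold>: \<tau>"

datatype fm =
    Eq tm tm (infix "\<^bold>=" 55)
  | Bot ("\<^bold>\<bottom>")
  | And fm fm (infixr "\<^bold>\<and>" 35)
  | Or fm fm (infixr "\<^bold>\<or>" 30)
  | Imp fm fm (infixr "\<^bold>\<longrightarrow>" 25)
  | All var fm ("(\<^bold>\<forall>_./ _)" [1000, 10] 10)
  | Ex var fm ("(\<^bold>\<exists>_./ _)" [1000, 10] 10)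

primrec wf_fm :: "fm \<Rightarrow> bool" where
  "wf_fm (s \<^bold>= t) = (\<exists>\<tau>. s \<^bold>: \<tau> \<and> t \<^bold>: \<tau>)"
| "wf_fm \<^bold>\<bottom> = True"
| "wf_fm (A \<^bold>\<and> B) = (wf_fm A \<and> wf_fm B)"
| "wf_fm (A \<^bold>\<or> B) = (wf_fm A \<and> wf_fm B)"
| "wf_fm (A \<^bold>\<longrightarrow> B) = (wf_fm A \<and> wf_fm B)"
| "wf_fm (\<^bold>\<forall>x. A) = wf_fm A"
| "wf_fm (\<^bold>\<exists>x. A) = wf_fm A"

primrec fv_tm :: "tm \<Rightarrow> var set" where
  "fv_tm (Var x) = {x}"
| "fv_tm (Lam x t) = fv_tm t - {x}"
| "fv_tm (s \<^bold>\<cdot> t) = fv_tm s \<union> fv_tm t"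
| "fv_tm Zero = {}"
| "fv_tm (Succ t) = fv_tm t"
| "fv_tm (Rec a b t) = fv_tm a \<union> fv_tm b \<union> fv_tm t"
| "fv_tm (Pair s t) = fv_tm s \<union> fv_tm t"
| "fv_tm (Fst t) = fv_tm t"
| "fv_tm (Snd t) = fv_tm t"

primrec fv :: "fm \<Rightarrow> var set" where
  "fv (s \<^bold>= t) = fv_tm s \<union> fv_tm t"
| "fv \<^bold>\<bottom> = {}"
| "fv (A \<^bold>\<and> B) = fv A \<union> fv B"
| "fv (A \<^bold>\<or> B) = fv A \<union> fv B"
| "fv (A \<^bold>\<longrightarrow> B) = fv A \<union> fv B"
| "fv (\<^bold>\<forall>x. A) = fv A - {x}"
| "fv (\<^bold>\<exists>x. A) = fv A - {x}"

text \<open>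
  Substitution of \<open>u\<close> for the free occurrences of \<open>x\<close> does not rename bound variables. It is used
  only when \<open>u\<close> is free for \<open>x\<close>, that is, when no free variable of \<open>u\<close> gets captured.
\<close>

primrec subst_tm :: "tm \<Rightarrow> tm \<Rightarrow> var \<Rightarrow> tm" where
  "subst_tm (Var y) u x = (if y = x then u else Var y)"
| "subst_tm (Lam y t) u x = Lam y (if y = x then t else subst_tm t u x)"
| "subst_tm (s \<^bold>\<cdot> t) u x = subst_tm s u x \<^bold>\<cdot> subst_tm t u x"
| "subst_tm Zero u x = Zero"
| "subst_tm (Succ t) u x = Succ (subst_tm t u x)"
| "subst_tm (Rec a b t) u x = Rec (subst_tm a u x) (subst_tm b u x) (subst_tm t u x)"
| "subst_tm (Pair s t) u x = Pair (subst_tm s u x) (subst_tm t u x)"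
| "subst_tm (Fst t) u x = Fst (subst_tm t u x)"
| "subst_tm (Snd t) u x = Snd (subst_tm t u x)"

primrec subst :: "fm \<Rightarrow> tm \<Rightarrow> var \<Rightarrow> fm" where
  "subst (s \<^bold>= t) u x = (subst_tm s u x \<^bold>= subst_tm t u x)"
| "subst \<^bold>\<bottom> u x = \<^bold>\<bottom>"
| "subst (A \<^bold>\<and> B) u x = (subst A u x \<^bold>\<and> subst B u x)"
| "subst (A \<^bold>\<or> B) u x = (subst A u x \<^bold>\<or> subst B u x)"
| "subst (A \<^bold>\<longrightarrow> B) u x = (subst A u x \<^bold>\<longrightarrow> subst B u x)"
| "subst (\<^bold>\<forall>y. A) u x = (\<^bold>\<forall>y. (if y = x then A else subst A u x))"
| "subst (\<^bold>\<exists>y. A) u x = (\<^bold>\<exists>y. (if y = x then A else subst A u x))"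

primrec free_for_tm :: "tm \<Rightarrow> var \<Rightarrow> tm \<Rightarrow> bool" where
  "free_for_tm u x (Var y) = True"
| "free_for_tm u x (Lam y t) = (x \<notin> fv_tm (Lam y t) \<or> y \<notin> fv_tm u \<and> free_for_tm u x t)"
| "free_for_tm u x (s \<^bold>\<cdot> t) = (free_for_tm u x s \<and> free_for_tm u x t)"
| "free_for_tm u x Zero = True"
| "free_for_tm u x (Succ t) = free_for_tm u x t"
| "free_for_tm u x (Rec a b t) = (free_for_tm u x a \<and> free_for_tm u x b \<and> free_for_tm u x t)"
| "free_for_tm u x (Pair s t) = (free_for_tm u x s \<and> free_for_tm u x t)"
| "free_for_tm u x (Fst t) = free_for_tm u x t"
| "free_for_tm u x (Snd t) = free_for_tm u x t"

primrec free_for :: "tm \<Rightarrow> var \<Rightarrow> fm \<Rightarrow> bool" where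
  "free_for u x (s \<^bold>= t) = (free_for_tm u x s \<and> free_for_tm u x t)"
| "free_for u x \<^bold>\<bottom> = True"
| "free_for u x (A \<^bold>\<and> B) = (free_for u x A \<and> free_for u x B)"
| "free_for u x (A \<^bold>\<or> B) = (free_for u x A \<and> free_for u x B)"
| "free_for u x (A \<^bold>\<longrightarrow> B) = (free_for u x A \<and> free_for u x B)"
| "free_for u x (\<^bold>\<forall>y. A) = (x \<notin> fv (\<^bold>\<forall>y. A) \<or> y \<notin> fv_tm u \<and> free_for u x A)"
| "free_for u x (\<^bold>\<exists>y. A) = (x \<notin> fv (\<^bold>\<exists>y. A) \<or> y \<notin> fv_tm u \<and> free_for u x A)"

text \<open>
  Natural deduction for intuitionistic logic, followed by extensional equality, the computation
  rules of the terms, Peano's axioms, and dependent choice. Typing premises are present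
  where a formula or term not constrained by the other premises enters, so only well-formed
  formulas are derivable.
\<close>

inductive derivable :: "fm set \<Rightarrow> fm \<Rightarrow> bool" (infix "\<^bold>\<turnstile>" 5) where
  Assm: "A \<in> H \<Longrightarrow> wf_fm A \<Longrightarrow> H \<^bold>\<turnstile> A"
| BotE: "H \<^bold>\<turnstile> \<^bold>\<bottom> \<Longrightarrow> wf_fm A \<Longrightarrow> H \<^bold>\<turnstile> A"
| AndI: "H \<^bold>\<turnstile> A \<Longrightarrow> H \<^bold>\<turnstile> B \<Longrightarrow> H \<^bold>\<turnstile> A \<^bold>\<and> B"
| AndE1: "H \<^bold>\<turnstile> A \<^bold>\<and> B \<Longrightarrow> H \<^bold>\<turnstile> A"
| AndE2: "H \<^bold>\<turnstile> A \<^bold>\<and> B \<Longrightarrow> H \<^bold>\<turnstile> B"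
| OrI1: "H \<^bold>\<turnstile> A \<Longrightarrow> wf_fm B \<Longrightarrow> H \<^bold>\<turnstile> A \<^bold>\<or> B"
| OrI2: "H \<^bold>\<turnstile> B \<Longrightarrow> wf_fm A \<Longrightarrow> H \<^bold>\<turnstile> A \<^bold>\<or> B"
| OrE: "H \<^bold>\<turnstile> A \<^bold>\<or> B \<Longrightarrow> insert A H \<^bold>\<turnstile> C \<Longrightarrow> insert B H \<^bold>\<turnstile> C \<Longrightarrow> H \<^bold>\<turnstile> C"
| ImpI: "insert A H \<^bold>\<turnstile> B \<Longrightarrow> wf_fm A \<Longrightarrow> H \<^bold>\<turnstile> A \<^bold>\<longrightarrow> B"
| ImpE: "H \<^bold>\<turnstile> A \<^bold>\<longrightarrow> B \<Longrightarrow> H \<^bold>\<turnstile> A \<Longrightarrow> H \<^bold>\<turnstile> B"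
| AllI: "H \<^bold>\<turnstile> A \<Longrightarrow> \<forall>B\<in>H. x \<notin> fv B \<Longrightarrow> H \<^bold>\<turnstile> (\<^bold>\<forall>x. A)"
| AllE: "H \<^bold>\<turnstile> (\<^bold>\<forall>x. A) \<Longrightarrow> t \<^bold>: snd x \<Longrightarrow> free_for t x A \<Longrightarrow> H \<^bold>\<turnstile> subst A t x"
| ExI: "H \<^bold>\<turnstile> subst A t x \<Longrightarrow> wf_fm A \<Longrightarrow> t \<^bold>: snd x \<Longrightarrow> free_for t x A \<Longrightarrow> H \<^bold>\<turnstile> (\<^bold>\<exists>x. A)"
| ExE: "H \<^bold>\<turnstile> (\<^bold>\<exists>x. A) \<Longrightarrow> insert A H \<^bold>\<turnstile> C \<Longrightarrow> x \<notin> fv C \<Longrightarrow> \<forall>B\<in>H. x \<notin> fv B \<Longrightarrow> H \<^bold>\<turnstile> C"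

| Refl: "t \<^bold>: \<tau> \<Longrightarrow> H \<^bold>\<turnstile> t \<^bold>= t"
| Leibniz: "H \<^bold>\<turnstile> s \<^bold>= t \<Longrightarrow> H \<^bold>\<turnstile> subst A s x \<Longrightarrow> wf_fm A \<Longrightarrow> s \<^bold>: snd x
    \<Longrightarrow> free_for s x A \<Longrightarrow> free_for t x A \<Longrightarrow> H \<^bold>\<turnstile> subst A t x"
| Ext: "H \<^bold>\<turnstile> (\<^bold>\<forall>x. s \<^bold>\<cdot> Var x \<^bold>= t \<^bold>\<cdot> Var x) \<Longrightarrow> x \<notin> fv_tm s \<Longrightarrow> x \<notin> fv_tm t \<Longrightarrow> H \<^bold>\<turnstile> s \<^bold>= t"

| Beta: "t \<^bold>: \<tau> \<Longrightarrow> s \<^bold>: snd x \<Longrightarrow> free_for_tm s x t \<Longrightarrow> H \<^bold>\<turnstile> Lam x t \<^bold>\<cdot> s \<^bold>= subst_tm t s x"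
| FstPair: "s \<^bold>: \<sigma> \<Longrightarrow> t \<^bold>: \<tau> \<Longrightarrow> H \<^bold>\<turnstile> Fst (Pair s t) \<^bold>= s"
| SndPair: "s \<^bold>: \<sigma> \<Longrightarrow> t \<^bold>: \<tau> \<Longrightarrow> H \<^bold>\<turnstile> Snd (Pair s t) \<^bold>= t"
| PairEta: "t \<^bold>: \<sigma> \<^bold>\<times> \<tau> \<Longrightarrow> H \<^bold>\<turnstile> Pair (Fst t) (Snd t) \<^bold>= t"
| RecZero: "a \<^bold>: \<tau> \<Longrightarrow> b \<^bold>: Nat \<^bold>\<Rightarrow> \<tau> \<^bold>\<Rightarrow> \<tau> \<Longrightarrow> H \<^bold>\<turnstile> Rec a b Zero \<^bold>= a"
| RecSucc: "a \<^bold>: \<tau> \<Longrightarrow> b \<^bold>: Nat \<^bold>\<Rightarrow> \<tau> \<^bold>\<Rightarrow> \<tau> \<Longrightarrow> t \<^bold>: Nat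
    \<Longrightarrow> H \<^bold>\<turnstile> Rec a b (Succ t) \<^bold>= b \<^bold>\<cdot> t \<^bold>\<cdot> Rec a b t"

| SuccNotZero: "H \<^bold>\<turnstile> Succ t \<^bold>= Zero \<Longrightarrow> H \<^bold>\<turnstile> \<^bold>\<bottom>"
| SuccInj: "H \<^bold>\<turnstile> Succ s \<^bold>= Succ t \<Longrightarrow> H \<^bold>\<turnstile> s \<^bold>= t"
| Induct: "H \<^bold>\<turnstile> subst A Zero x \<Longrightarrow> H \<^bold>\<turnstile> (\<^bold>\<forall>x. A \<^bold>\<longrightarrow> subst A (Succ (Var x)) x) \<Longrightarrow> snd x = Nat
    \<Longrightarrow> H \<^bold>\<turnstile> (\<^bold>\<forall>x. A)"

| DC: "H \<^bold>\<turnstile> (\<^bold>\<forall>x. \<^bold>\<exists>y. A)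
    \<Longrightarrow> snd x = \<sigma> \<Longrightarrow> snd y = \<sigma> \<Longrightarrow> snd f = (Nat \<^bold>\<Rightarrow> \<sigma>) \<Longrightarrow> snd n = Nat
    \<Longrightarrow> distinct [x, y, f, n] \<Longrightarrow> f \<notin> fv A \<Longrightarrow> n \<notin> fv A
    \<Longrightarrow> free_for (Var f \<^bold>\<cdot> Var n) x A
    \<Longrightarrow> free_for (Var f \<^bold>\<cdot> Succ (Var n)) y (subst A (Var f \<^bold>\<cdot> Var n) x)
    \<Longrightarrow> H \<^bold>\<turnstile> (\<^bold>\<forall>x. \<^bold>\<exists>f. Var f \<^bold>\<cdot> Zero \<^bold>= Var x \<^bold>\<and>
          (\<^bold>\<forall>n. subst (subst A (Var f \<^bold>\<cdot> Var n) x) (Var f \<^bold>\<cdot> Succ (Var n)) y))"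

text \<open>
  The order on \<open>Nat\<close> is given through truncated subtraction: \<open>s \<le> t\<close> iff \<open>s - t = 0\<close>. All binders
  in these terms are inside closed subterms, so no variable of \<open>s\<close> or \<open>t\<close> is captured.
\<close>

definition pred_fun :: tm where
  "pred_fun = Lam (''x'', Nat) (Rec Zero (Lam (''y'', Nat) (Lam (''z'', Nat) (Var (''y'', Nat)))) (Var (''x'', Nat)))"

definition monus :: "tm \<Rightarrow> tm \<Rightarrow> tm" where
  "monus s t = Rec s (Lam (''y'', Nat) pred_fun) t"

definition Le :: "tm \<Rightarrow> tm \<Rightarrow> fm" (infix "\<^bold>\<le>" 55) where
  "s \<^bold>\<le> t = (monus s t \<^bold>= Zero)"

definition Less :: "tm \<Rightarrow> tm \<Rightarrow> fm" (infix "\<^bold><" 55) where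
  "s \<^bold>< t = (Succ s \<^bold>\<le> t)"

text \<open>A sequence in \<open>{0, 1}\<close> is a function on \<open>Nat\<close> all of whose values are 0 or 1.\<close>

definition LPO :: fm where
  "LPO = (let \<alpha> = (''a'', Nat \<^bold>\<Rightarrow> Nat); n = (''n'', Nat) in
     \<^bold>\<forall>\<alpha>. (\<^bold>\<forall>n. Var \<alpha> \<^bold>\<cdot> Var n \<^bold>= Zero \<^bold>\<or> Var \<alpha> \<^bold>\<cdot> Var n \<^bold>= Succ Zero) \<^bold>\<longrightarrow>
       (\<^bold>\<exists>n. Var \<alpha> \<^bold>\<cdot> Var n \<^bold>= Succ Zero) \<^bold>\<or> (\<^bold>\<forall>n. Var \<alpha> \<^bold>\<cdot> Var n \<^bold>= Zero))"

text \<open>The infinite set of indices is the range of the strictly increasing sequence \<open>i\<close>.\<close>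

definition DL_1_inf :: fm where
  "DL_1_inf = (let \<alpha> = (''a'', Nat \<^bold>\<Rightarrow> Nat); i = (''i'', Nat \<^bold>\<Rightarrow> Nat);
       m = (''m'', Nat); n = (''n'', Nat) in
     \<^bold>\<forall>\<alpha>. \<^bold>\<exists>i.
       (\<^bold>\<forall>m. \<^bold>\<forall>n. Var m \<^bold>< Var n \<^bold>\<longrightarrow> Var i \<^bold>\<cdot> Var m \<^bold>< Var i \<^bold>\<cdot> Var n) \<^bold>\<and>
       (\<^bold>\<forall>m. \<^bold>\<forall>n. Var m \<^bold>< Var n \<^bold>\<longrightarrow>
          Var \<alpha> \<^bold>\<cdot> (Var i \<^bold>\<cdot> Var m) \<^bold>\<le> Var \<alpha> \<^bold>\<cdot> (Var i \<^bold>\<cdot> Var n)))"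

end

theory Submission
  imports Defs
begin

text \<open>
  Constructively, the theorem rests on one consequence of LPO: every tail of a sequence \<open>\<alpha>\<close> of
  natural numbers attains its minimum, that is, for every \<open>x\<close> there is \<open>y > x\<close> with
  \<open>\<alpha> y \<le> \<alpha> j\<close> for all \<open>j > x\<close>. To find \<open>y\<close>, start from any \<open>k > x\<close>. By LPO, applied to the
  characteristic function of a decidable predicate, either some \<open>j > x\<close> has \<open>\<alpha> j < \<alpha> k\<close>, or \<open>k\<close>
  is a minimum; in the first case continue with \<open>j\<close>. The search ends because \<open>\<alpha> k\<close> decreases, so
  it is an induction on a bound of \<open>\<alpha> k\<close> (lemma \<open>tail_min_exists\<close>).

  Dependent choice then gives \<open>f\<close> such that \<open>f (m + 1)\<close> is a position of the minimum of the tail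
  beyond \<open>f m\<close>. Such an \<open>f\<close> is strictly increasing, and \<open>\<alpha> (f (m + 1)) \<le> \<alpha> j\<close> for all
  \<open>j > f m\<close>; therefore \<open>i m = f (m + 1)\<close> is the required sequence of indices.

  The argument has to be carried out as a derivation in the formal system. Derivations are built
  in a sequent relation \<open>\<Gamma> \<tturnstile> A\<close>, which stands for the derivability of \<open>\<Gamma> \<longrightarrow> A\<close> from the empty set
  of hypotheses and which, unlike \<open>\<^bold>\<turnstile>\<close> itself, is easily seen to admit weakening. This allows
  arithmetical facts to be derived once, in the empty context, and used in all contexts. They are
  stated for arbitrary terms, as rules between sequents.
\<close>

section \<open>Typing, substitution and well-formedness\<close>

lemma has_type_iffs [simp]:
  "Var x \<^bold>: \<tau> \<longleftrightarrow> \<tau> = snd x"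
  "Lam x t \<^bold>: \<tau> \<longleftrightarrow> (\<exists>\<rho>. \<tau> = (snd x \<^bold>\<Rightarrow> \<rho>) \<and> t \<^bold>: \<rho>)"
  "s \<^bold>\<cdot> t \<^bold>: \<tau> \<longleftrightarrow> (\<exists>\<sigma>. s \<^bold>: \<sigma> \<^bold>\<Rightarrow> \<tau> \<and> t \<^bold>: \<sigma>)"
  "Zero \<^bold>: \<tau> \<longleftrightarrow> \<tau> = Nat"
  "Succ t \<^bold>: \<tau> \<longleftrightarrow> \<tau> = Nat \<and> t \<^bold>: Nat"
  "Rec a b t \<^bold>: \<tau> \<longleftrightarrow> a \<^bold>: \<tau> \<and> b \<^bold>: Nat \<^bold>\<Rightarrow> \<tau> \<^bold>\<Rightarrow> \<tau> \<and> t \<^bold>: Nat"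
  "Pair s t \<^bold>: \<tau> \<longleftrightarrow> (\<exists>\<rho> \<sigma>. \<tau> = \<rho> \<^bold>\<times> \<sigma> \<and> s \<^bold>: \<rho> \<and> t \<^bold>: \<sigma>)"
  "Fst t \<^bold>: \<tau> \<longleftrightarrow> (\<exists>\<sigma>. t \<^bold>: \<tau> \<^bold>\<times> \<sigma>)"
  "Snd t \<^bold>: \<tau> \<longleftrightarrow> (\<exists>\<rho>. t \<^bold>: \<rho> \<^bold>\<times> \<tau>)"
  by (auto elim: has_type.cases intro: has_type.intros)

text \<open>
  Variables carry their types, so a term has at most one type. This is what recovers the type of
  one side of a derivable equation from the type of the other side.
\<close>

lemma has_type_unique: "t \<^bold>: \<sigma> \<Longrightarrow> t \<^bold>: \<tau> \<Longrightarrow> \<sigma> = \<tau>"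
proof (induction t arbitrary: \<sigma> \<tau>)
  case (App s t)
  then show ?case by (metis has_type_iffs(3) ty.inject(1))
next
  case (Pair s t)
  then show ?case by (metis has_type_iffs(7))
next
  case (Fst t)
  then show ?case by (metis has_type_iffs(8) ty.inject(2))
next
  case (Snd t)
  then show ?case by (metis has_type_iffs(9) ty.inject(2))
qed auto

lemma has_type_subst: "t \<^bold>: \<tau> \<Longrightarrow> u \<^bold>: snd x \<Longrightarrow> subst_tm t u x \<^bold>: \<tau>"
proof (induction t arbitrary: \<tau>)
  case (App s t)
  then show ?case by (metis has_type_iffs(3) subst_tm.simps(3))
qed (fastforce split: if_splits)+

lemma wf_fm_subst: "wf_fm A \<Longrightarrow> u \<^bold>: snd x \<Longrightarrow> wf_fm (subst A u x)"
  by (induction A) (auto intro: has_type_subst)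

lemma subst_tm_fresh [simp]: "x \<notin> fv_tm t \<Longrightarrow> subst_tm t u x = t"
  by (induction t) auto

lemma subst_fresh [simp]: "x \<notin> fv A \<Longrightarrow> subst A u x = A"
  by (induction A) auto

lemma free_for_tm_fresh [simp]: "x \<notin> fv_tm t \<Longrightarrow> free_for_tm u x t"
  by (induction t) auto

lemma free_for_fresh [simp]: "x \<notin> fv A \<Longrightarrow> free_for u x A"
  by (induction A) auto

lemma subst_tm_self [simp]: "subst_tm t (Var x) x = t"
  by (induction t) auto

lemma subst_self [simp]: "subst A (Var x) x = A"
  by (induction A) auto

lemma free_for_tm_self [simp]: "free_for_tm (Var x) x t"
  by (induction t) auto

lemma free_for_self [simp]: "free_for (Var x) x A"
  by (induction A) auto

lemma fv_subst_tm: "x \<notin> fv_tm u \<Longrightarrow> x \<notin> fv_tm (subst_tm t u x)"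
  by (induction t) auto

lemma finite_fv_tm [simp]: "finite (fv_tm t)"
  by (induction t) auto

text \<open>
  Substitution does not rename bound variables. The rules for arbitrary terms below are therefore
  derived with variables chosen fresh for these terms.
\<close>

lemma fresh_var:
  assumes "finite S"
  obtains x :: var where "snd x = \<tau>" "x \<notin> S"
proof -
  have "infinite (range (\<lambda>s::string. (s, \<tau>)))"
    by (auto dest!: finite_imageD intro: inj_onI simp: infinite_UNIV_listI)
  then obtain x where "x \<in> range (\<lambda>s. (s, \<tau>))" "x \<notin> S"
    using assms by (meson finite_subset subsetI)
  then show thesis using that by auto
qed

lemma derivable_wf: "H \<^bold>\<turnstile> A \<Longrightarrow> wf_fm A"
proof (induction rule: derivable.induct)
  case (Leibniz H s t A x)
  then show ?case by (metis has_type_unique wf_fm.simps(1) wf_fm_subst)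
next
  case (Ext H x s t)
  then show ?case by auto
next
  case (DC H x y A \<sigma> f n)
  then show ?case by (auto intro!: wf_fm_subst)
qed (auto simp: wf_fm_subst intro: has_type_subst has_type.intros)

section \<open>Sequents over the empty set of hypotheses\<close>

text \<open>
  In \<open>H \<^bold>\<turnstile> A\<close> a derivation may generalize over a variable that occurs free in a formula to be added
  to \<open>H\<close>, so \<open>\<^bold>\<turnstile>\<close> is not evidently closed under weakening. Moving all hypotheses into the formula
  removes the obstacle: from \<open>{} \<^bold>\<turnstile> A\<close> the formula \<open>B \<^bold>\<longrightarrow> A\<close> follows by modus ponens with
  \<open>A \<^bold>\<longrightarrow> B \<^bold>\<longrightarrow> A\<close>. The head of the list becomes the innermost premise, so that the introduction
  of an implication holds by definition.
\<close>

primrec imps :: "fm list \<Rightarrow> fm \<Rightarrow> fm" where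
  "imps [] A = A"
| "imps (B # \<Gamma>) A = imps \<Gamma> (B \<^bold>\<longrightarrow> A)"

abbreviation wf_ctxt :: "fm list \<Rightarrow> bool" where
  "wf_ctxt \<Gamma> \<equiv> \<forall>B\<in>set \<Gamma>. wf_fm B"

definition sequent :: "fm list \<Rightarrow> fm \<Rightarrow> bool" (infix "\<tturnstile>" 5) where
  "(\<Gamma> \<tturnstile> A) \<longleftrightarrow> ({} \<^bold>\<turnstile> imps \<Gamma> A)"

lemma wf_imps: "wf_fm (imps \<Gamma> A) \<longleftrightarrow> (wf_ctxt \<Gamma>) \<and> wf_fm A"
  by (induction \<Gamma> arbitrary: A) auto

lemma seq_wf: "\<Gamma> \<tturnstile> A \<Longrightarrow> wf_fm A"
  unfolding sequent_def by (drule derivable_wf) (simp add: wf_imps)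

lemma seq_wf_ctxt: "\<Gamma> \<tturnstile> A \<Longrightarrow> wf_ctxt \<Gamma>"
  unfolding sequent_def by (drule derivable_wf) (simp add: wf_imps)

lemma seq_Nil: "([] \<tturnstile> A) \<longleftrightarrow> ({} \<^bold>\<turnstile> A)"
  by (simp add: sequent_def)

lemma seq_Cons: "(B # \<Gamma> \<tturnstile> A) \<longleftrightarrow> (\<Gamma> \<tturnstile> B \<^bold>\<longrightarrow> A)"
  by (simp add: sequent_def)

lemmas imp_intro = seq_Cons [THEN iffD1]

text \<open>
  Theorems may be used in every context; this is the instance of weakening on which all
  arithmetical lemmas depend.
\<close>

lemma seq_theorem: "{} \<^bold>\<turnstile> A \<Longrightarrow> wf_ctxt \<Gamma> \<Longrightarrow> \<Gamma> \<tturnstile> A"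
proof (induction \<Gamma> arbitrary: A)
  case Nil
  then show ?case by (simp add: seq_Nil)
next
  case (Cons B \<Gamma>)
  have "wf_fm A" using Cons.prems(1) by (rule derivable_wf)
  then have "{} \<^bold>\<turnstile> A \<^bold>\<longrightarrow> B \<^bold>\<longrightarrow> A"
    using Cons.prems(2) by (intro ImpI Assm) auto
  then have "{} \<^bold>\<turnstile> B \<^bold>\<longrightarrow> A"
    using Cons.prems(1) by (rule ImpE)
  with Cons show ?case by (simp add: seq_Cons)
qed

text \<open>
  This lemma and the next are the combinators \<open>(A \<longrightarrow> B) \<longrightarrow> (C \<longrightarrow> A) \<longrightarrow> (C \<longrightarrow> B)\<close> and
  \<open>(C \<longrightarrow> A \<longrightarrow> B) \<longrightarrow> (C \<longrightarrow> A) \<longrightarrow> (C \<longrightarrow> B)\<close>, iterated along the context.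
\<close>

lemma seq_mono: "{} \<^bold>\<turnstile> A \<^bold>\<longrightarrow> B \<Longrightarrow> \<Gamma> \<tturnstile> A \<Longrightarrow> \<Gamma> \<tturnstile> B"
proof (induction \<Gamma> arbitrary: A B)
  case Nil
  then show ?case unfolding seq_Nil by (rule ImpE)
next
  case (Cons C \<Gamma>)
  have wf: "wf_fm A" "wf_fm B" "wf_fm C"
    using derivable_wf [OF Cons.prems(1)] seq_wf_ctxt [OF Cons.prems(2)] by auto
  let ?H = "{C, C \<^bold>\<longrightarrow> A, A \<^bold>\<longrightarrow> B}"
  have "?H \<^bold>\<turnstile> A"
    by (rule ImpE [of _ C]; rule Assm) (use wf in auto)
  then have "?H \<^bold>\<turnstile> B"
    by (rule ImpE [rotated], intro Assm) (use wf in auto)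
  then have "{A \<^bold>\<longrightarrow> B} \<^bold>\<turnstile> (C \<^bold>\<longrightarrow> A) \<^bold>\<longrightarrow> (C \<^bold>\<longrightarrow> B)"
    using wf by (intro ImpI) (simp_all add: insert_commute)
  then have "{} \<^bold>\<turnstile> (C \<^bold>\<longrightarrow> A) \<^bold>\<longrightarrow> (C \<^bold>\<longrightarrow> B)"
    by (rule ImpE [OF ImpI]) (use Cons.prems(1) wf in auto)
  with Cons show ?case unfolding seq_Cons by blast
qed

lemma imp_elim: "\<Gamma> \<tturnstile> A \<^bold>\<longrightarrow> B \<Longrightarrow> \<Gamma> \<tturnstile> A \<Longrightarrow> \<Gamma> \<tturnstile> B"
proof (induction \<Gamma> arbitrary: A B)
  case Nil
  then show ?case unfolding seq_Nil by (rule ImpE)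
next
  case (Cons C \<Gamma>)
  have wf: "wf_fm A" "wf_fm B" "wf_fm C"
    using seq_wf [OF Cons.prems(1)] seq_wf_ctxt [OF Cons.prems(1)] by auto
  let ?H = "{C, C \<^bold>\<longrightarrow> A, C \<^bold>\<longrightarrow> A \<^bold>\<longrightarrow> B}"
  have "?H \<^bold>\<turnstile> A" "?H \<^bold>\<turnstile> A \<^bold>\<longrightarrow> B"
    by (rule ImpE [of _ C]; rule Assm; use wf in auto)+
  then have "?H \<^bold>\<turnstile> B"
    by (rule ImpE [rotated])
  then have "{} \<^bold>\<turnstile> (C \<^bold>\<longrightarrow> A \<^bold>\<longrightarrow> B) \<^bold>\<longrightarrow> (C \<^bold>\<longrightarrow> A) \<^bold>\<longrightarrow> (C \<^bold>\<longrightarrow> B)"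
    using wf by (intro ImpI) (simp_all add: insert_commute)
  then have "\<Gamma> \<tturnstile> (C \<^bold>\<longrightarrow> A) \<^bold>\<longrightarrow> (C \<^bold>\<longrightarrow> B)"
    using Cons.prems(1) unfolding seq_Cons by (rule seq_mono)
  with Cons show ?case unfolding seq_Cons by blast
qed

lemma hyp: "A \<in> set \<Gamma> \<Longrightarrow> wf_ctxt \<Gamma> \<Longrightarrow> \<Gamma> \<tturnstile> A"
proof (induction \<Gamma>)
  case (Cons C \<Gamma>)
  show ?case
  proof (cases "A = C")
    case True
    have "{} \<^bold>\<turnstile> C \<^bold>\<longrightarrow> C"
      using Cons.prems by (intro ImpI Assm) auto
    then show ?thesis
      using Cons.prems True by (simp add: seq_Cons seq_theorem)
  next
    case False
    have "{} \<^bold>\<turnstile> A \<^bold>\<longrightarrow> C \<^bold>\<longrightarrow> A"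
      using Cons.prems by (intro ImpI Assm) auto
    then show ?thesis
      unfolding seq_Cons by (rule seq_mono) (use Cons False in auto)
  qed
qed auto

text \<open>
  A rule of the calculus acts on sequents as soon as its conclusion is derivable from exactly its
  premises taken as hypotheses. The rules of natural deduction are transferred in this way.
\<close>

lemma seq_rule1: "{A} \<^bold>\<turnstile> B \<Longrightarrow> \<Gamma> \<tturnstile> A \<Longrightarrow> \<Gamma> \<tturnstile> B"
  by (rule seq_mono [OF ImpI]) (auto dest: seq_wf)

lemma seq_rule2:
  assumes "{A, B} \<^bold>\<turnstile> C" and "\<Gamma> \<tturnstile> A" and "\<Gamma> \<tturnstile> B"
  shows "\<Gamma> \<tturnstile> C"
proof (rule imp_elim)
  show "\<Gamma> \<tturnstile> B \<^bold>\<longrightarrow> C"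
    using assms(1) seq_wf [OF assms(3)]
    by (intro seq_rule1 [OF ImpI assms(2)]) (simp_all add: insert_commute)
qed fact

lemma seq_rule3:
  assumes "{A, B, C} \<^bold>\<turnstile> D" and "\<Gamma> \<tturnstile> A" and "\<Gamma> \<tturnstile> B" and "\<Gamma> \<tturnstile> C"
  shows "\<Gamma> \<tturnstile> D"
proof (rule imp_elim)
  show "\<Gamma> \<tturnstile> C \<^bold>\<longrightarrow> D"
    using assms(1) seq_wf [OF assms(4)]
    by (intro seq_rule2 [OF ImpI assms(2,3)]) (simp_all add: insert_commute)
qed fact

lemma seq_weaken:
  assumes "\<Gamma> \<tturnstile> A" and "wf_fm B"
  shows "B # \<Gamma> \<tturnstile> A"
proof -
  have "{A} \<^bold>\<turnstile> B \<^bold>\<longrightarrow> A"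
    using assms(2) seq_wf [OF assms(1)] by (intro ImpI Assm) auto
  then show ?thesis
    using assms(1) unfolding seq_Cons by (rule seq_rule1)
qed

lemma bot_elim: "\<Gamma> \<tturnstile> \<^bold>\<bottom> \<Longrightarrow> wf_fm A \<Longrightarrow> \<Gamma> \<tturnstile> A"
  by (rule seq_rule1, rule BotE, rule Assm) simp_all

lemma and_intro: "\<Gamma> \<tturnstile> A \<Longrightarrow> \<Gamma> \<tturnstile> B \<Longrightarrow> \<Gamma> \<tturnstile> A \<^bold>\<and> B"
  by (rule seq_rule2 [of A B], rule AndI; (rule Assm)?) (simp_all add: seq_wf)

lemma and_elim1: "\<Gamma> \<tturnstile> A \<^bold>\<and> B \<Longrightarrow> \<Gamma> \<tturnstile> A"
  by (rule seq_rule1 [of "A \<^bold>\<and> B"], rule AndE1, rule Assm) (auto dest: seq_wf)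

lemma and_elim2: "\<Gamma> \<tturnstile> A \<^bold>\<and> B \<Longrightarrow> \<Gamma> \<tturnstile> B"
  by (rule seq_rule1 [of "A \<^bold>\<and> B"], rule AndE2, rule Assm) (auto dest: seq_wf)

lemma or_intro1: "\<Gamma> \<tturnstile> A \<Longrightarrow> wf_fm B \<Longrightarrow> \<Gamma> \<tturnstile> A \<^bold>\<or> B"
  by (rule seq_rule1 [of A], rule OrI1, rule Assm) (auto dest: seq_wf)

lemma or_intro2: "\<Gamma> \<tturnstile> B \<Longrightarrow> wf_fm A \<Longrightarrow> \<Gamma> \<tturnstile> A \<^bold>\<or> B"
  by (rule seq_rule1 [of B], rule OrI2, rule Assm) (auto dest: seq_wf)

lemma or_elim:
  assumes "\<Gamma> \<tturnstile> A \<^bold>\<or> B" "A # \<Gamma> \<tturnstile> C" "B # \<Gamma> \<tturnstile> C"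
  shows "\<Gamma> \<tturnstile> C"
proof (rule seq_rule3)
  show "\<Gamma> \<tturnstile> A \<^bold>\<or> B" "\<Gamma> \<tturnstile> A \<^bold>\<longrightarrow> C" "\<Gamma> \<tturnstile> B \<^bold>\<longrightarrow> C"
    using assms by (auto simp: seq_Cons)
  let ?H = "{A \<^bold>\<or> B, A \<^bold>\<longrightarrow> C, B \<^bold>\<longrightarrow> C}"
  have wf: "wf_fm A" "wf_fm B" "wf_fm C"
    using seq_wf [OF assms(1)] seq_wf [OF assms(2)] by auto
  show "?H \<^bold>\<turnstile> C"
  proof (rule OrE [of _ A B])
    show "?H \<^bold>\<turnstile> A \<^bold>\<or> B" using wf by (auto intro: Assm)
    show "insert A ?H \<^bold>\<turnstile> C" by (rule ImpE [of _ A]; rule Assm) (use wf in auto)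
    show "insert B ?H \<^bold>\<turnstile> C" by (rule ImpE [of _ B]; rule Assm) (use wf in auto)
  qed
qed

text \<open>
  Generalization takes place in the empty set of hypotheses. The quantifier is then moved inwards
  past one formula of the context at a time, by \<open>(\<forall>x. C \<longrightarrow> A) \<longrightarrow> (C \<longrightarrow> (\<forall>x. A))\<close> for \<open>x\<close> not free
  in \<open>C\<close>.
\<close>

lemma all_intro: "\<Gamma> \<tturnstile> A \<Longrightarrow> \<forall>B\<in>set \<Gamma>. x \<notin> fv B \<Longrightarrow> \<Gamma> \<tturnstile> (\<^bold>\<forall>x. A)"
proof (induction \<Gamma> arbitrary: A)
  case Nil
  then show ?case unfolding seq_Nil by (intro AllI) auto
next
  case (Cons C \<Gamma>)
  have wf: "wf_fm A" "wf_fm C"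
    using seq_wf [OF Cons.prems(1)] seq_wf_ctxt [OF Cons.prems(1)] by auto
  let ?H = "{C, \<^bold>\<forall>x. C \<^bold>\<longrightarrow> A}"
  have "?H \<^bold>\<turnstile> subst (C \<^bold>\<longrightarrow> A) (Var x) x"
    by (rule AllE, rule Assm) (use wf in auto)
  then have "?H \<^bold>\<turnstile> C \<^bold>\<longrightarrow> A"
    by simp
  then have "?H \<^bold>\<turnstile> A"
    by (rule ImpE) (use wf in \<open>auto intro: Assm\<close>)
  then have "{\<^bold>\<forall>x. C \<^bold>\<longrightarrow> A} \<^bold>\<turnstile> C \<^bold>\<longrightarrow> (\<^bold>\<forall>x. A)"
    using wf Cons.prems by (intro ImpI AllI) auto
  then show ?case
    using Cons seq_rule1 unfolding seq_Cons by simp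
qed

lemma all_elim:
  assumes "\<Gamma> \<tturnstile> (\<^bold>\<forall>x. A)" "t \<^bold>: snd x" "free_for t x A" "B = subst A t x"
  shows "\<Gamma> \<tturnstile> B"
proof -
  have "{\<^bold>\<forall>x. A} \<^bold>\<turnstile> subst A t x"
    by (rule AllE, rule Assm) (use assms(2,3) seq_wf [OF assms(1)] in auto)
  then show ?thesis
    unfolding assms(4) using assms(1) by (rule seq_rule1)
qed

lemma ex_intro:
  assumes "\<Gamma> \<tturnstile> subst A t x" "wf_fm A" "t \<^bold>: snd x" "free_for t x A"
  shows "\<Gamma> \<tturnstile> (\<^bold>\<exists>x. A)"
proof -
  have "{subst A t x} \<^bold>\<turnstile> (\<^bold>\<exists>x. A)"
    by (rule ExI, rule Assm) (use assms seq_wf [OF assms(1)] in auto)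
  then show ?thesis
    using assms(1) by (rule seq_rule1)
qed

lemma ex_elim:
  assumes "\<Gamma> \<tturnstile> (\<^bold>\<exists>x. A)" "A # \<Gamma> \<tturnstile> C" "x \<notin> fv C" "\<forall>B\<in>set \<Gamma>. x \<notin> fv B"
  shows "\<Gamma> \<tturnstile> C"
proof (rule seq_rule2)
  show "\<Gamma> \<tturnstile> (\<^bold>\<exists>x. A)" by fact
  show "\<Gamma> \<tturnstile> (\<^bold>\<forall>x. A \<^bold>\<longrightarrow> C)"
    using assms by (intro all_intro) (auto simp: seq_Cons)
  have wf: "wf_fm A" "wf_fm C"
    using seq_wf [OF assms(1)] seq_wf [OF assms(2)] by auto
  let ?H = "{\<^bold>\<exists>x. A, \<^bold>\<forall>x. A \<^bold>\<longrightarrow> C}"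
  have "insert A ?H \<^bold>\<turnstile> subst (A \<^bold>\<longrightarrow> C) (Var x) x"
    by (rule AllE, rule Assm) (use wf in auto)
  then have "insert A ?H \<^bold>\<turnstile> A \<^bold>\<longrightarrow> C"
    using assms by simp
  then have C: "insert A ?H \<^bold>\<turnstile> C"
    by (rule ImpE) (use wf in \<open>auto intro: Assm\<close>)
  show "?H \<^bold>\<turnstile> C"
    by (rule ExE [OF Assm C]) (use wf assms in auto)
qed

lemma nat_induct_rule:
  assumes "\<Gamma> \<tturnstile> subst A Zero x" "A # \<Gamma> \<tturnstile> subst A (Succ (Var x)) x"
    and "snd x = Nat" "\<forall>B\<in>set \<Gamma>. x \<notin> fv B"
  shows "\<Gamma> \<tturnstile> (\<^bold>\<forall>x. A)"
proof (rule seq_rule2)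
  show "\<Gamma> \<tturnstile> subst A Zero x" by fact
  show "\<Gamma> \<tturnstile> (\<^bold>\<forall>x. A \<^bold>\<longrightarrow> subst A (Succ (Var x)) x)"
    using assms by (intro all_intro) (auto simp: seq_Cons)
  show "{subst A Zero x, \<^bold>\<forall>x. A \<^bold>\<longrightarrow> subst A (Succ (Var x)) x} \<^bold>\<turnstile> (\<^bold>\<forall>x. A)"
    by (rule Induct; (rule Assm)?)
      (use assms(3) seq_wf [OF assms(1)] seq_wf [OF assms(2)] seq_wf_ctxt [OF assms(2)] in auto)
qed

lemma nat_induct_term:
  assumes "\<Gamma> \<tturnstile> subst A Zero x" "A # \<Gamma> \<tturnstile> subst A (Succ (Var x)) x"
    and "snd x = Nat" "\<forall>B\<in>set \<Gamma>. x \<notin> fv B" "t \<^bold>: Nat" "free_for t x A"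
  shows "\<Gamma> \<tturnstile> subst A t x"
  using assms by (intro all_elim [OF nat_induct_rule [OF assms(1,2)]]) simp_all

lemma leibniz:
  assumes "\<Gamma> \<tturnstile> s \<^bold>= t" "\<Gamma> \<tturnstile> subst A s x" "wf_fm A" "s \<^bold>: snd x"
    "free_for s x A" "free_for t x A"
  shows "\<Gamma> \<tturnstile> subst A t x"
  by (rule seq_rule2 [OF _ assms(1,2)], rule Leibniz [of _ s]; (rule Assm)?)
    (use assms seq_wf [OF assms(1)] seq_wf [OF assms(2)] in \<open>simp_all del: wf_fm.simps\<close>)

lemma dependent_choice:
  assumes "\<Gamma> \<tturnstile> (\<^bold>\<forall>x. \<^bold>\<exists>y. A)"
    and "snd x = \<sigma>" "snd y = \<sigma>" "snd f = (Nat \<^bold>\<Rightarrow> \<sigma>)" "snd n = Nat"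
    and "distinct [x, y, f, n]" "f \<notin> fv A" "n \<notin> fv A"
    and "free_for (Var f \<^bold>\<cdot> Var n) x A"
    and "free_for (Var f \<^bold>\<cdot> Succ (Var n)) y (subst A (Var f \<^bold>\<cdot> Var n) x)"
  shows "\<Gamma> \<tturnstile> (\<^bold>\<forall>x. \<^bold>\<exists>f. Var f \<^bold>\<cdot> Zero \<^bold>= Var x \<^bold>\<and>
    (\<^bold>\<forall>n. subst (subst A (Var f \<^bold>\<cdot> Var n) x) (Var f \<^bold>\<cdot> Succ (Var n)) y))"
  using assms(1)
  by (rule seq_rule1 [rotated], intro DC [OF Assm assms(2-)])
    (use seq_wf [OF assms(1)] in auto)

section \<open>Equality and truncated subtraction\<close>

lemma eq_refl: "t \<^bold>: \<tau> \<Longrightarrow> wf_ctxt \<Gamma> \<Longrightarrow> \<Gamma> \<tturnstile> t \<^bold>= t"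
  by (intro seq_theorem Refl)

text \<open>
  The hole of the context \<open>r\<close> is the variable \<open>x\<close>. Leibniz' rule replaces \<open>s\<close> by \<open>t\<close> only in the
  right-hand side of \<open>r[s] = r[s]\<close>: as \<open>x\<close> is not free in \<open>s\<close>, the left-hand side \<open>r[s]\<close> no longer
  contains it.
\<close>

lemma eq_cong:
  assumes "\<Gamma> \<tturnstile> s \<^bold>= t" "s \<^bold>: snd x" "r \<^bold>: \<tau>" "x \<notin> fv_tm s"
    "free_for_tm s x r" "free_for_tm t x r"
  shows "\<Gamma> \<tturnstile> subst_tm r s x \<^bold>= subst_tm r t x"
proof -
  have type: "subst_tm r s x \<^bold>: \<tau>"
    using assms(2,3) by (simp add: has_type_subst)
  have "\<Gamma> \<tturnstile> subst (subst_tm r s x \<^bold>= r) t x"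
  proof (rule leibniz [OF assms(1)])
    show "\<Gamma> \<tturnstile> subst (subst_tm r s x \<^bold>= r) s x"
      using assms(4) seq_wf_ctxt [OF assms(1)] type by (simp add: fv_subst_tm eq_refl)
    show "wf_fm (subst_tm r s x \<^bold>= r)"
      using assms(3) type by auto
  qed (use assms in \<open>auto simp: fv_subst_tm\<close>)
  then show ?thesis using assms(4) by (simp add: fv_subst_tm)
qed

lemma eq_sym:
  assumes "\<Gamma> \<tturnstile> s \<^bold>= t"
  shows "\<Gamma> \<tturnstile> t \<^bold>= s"
proof -
  obtain \<tau> where \<tau>: "s \<^bold>: \<tau>" "t \<^bold>: \<tau>" using seq_wf [OF assms] by auto
  obtain x where x: "snd x = \<tau>" "x \<notin> fv_tm s" using fresh_var [of "fv_tm s"] by auto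
  have "\<Gamma> \<tturnstile> subst (Var x \<^bold>= s) t x"
    using assms \<tau> x by (intro leibniz [OF assms]) (auto intro!: eq_refl dest: seq_wf_ctxt)
  then show ?thesis using x by simp
qed

lemma eq_trans [trans]:
  assumes "\<Gamma> \<tturnstile> r \<^bold>= s" "\<Gamma> \<tturnstile> s \<^bold>= t"
  shows "\<Gamma> \<tturnstile> r \<^bold>= t"
proof -
  obtain \<tau> where \<tau>: "r \<^bold>: \<tau>" "s \<^bold>: \<tau>" using seq_wf [OF assms(1)] by auto
  obtain x where x: "snd x = \<tau>" "x \<notin> fv_tm r" using fresh_var [of "fv_tm r"] by auto
  have "\<Gamma> \<tturnstile> subst (r \<^bold>= Var x) t x"
    using assms \<tau> x by (intro leibniz [OF assms(2)]) auto
  then show ?thesis using x by simp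
qed

text \<open>
  Congruence with a hole that avoids any given finite set \<open>S\<close> of variables, as needed when the
  surrounding term has free variables of its own.
\<close>

lemma eq_cong_at:
  assumes "\<Gamma> \<tturnstile> s \<^bold>= t" "s \<^bold>: \<sigma>"
    and "\<And>x. snd x = \<sigma> \<Longrightarrow> x \<notin> fv_tm s \<union> S \<Longrightarrow>
      \<exists>r. r \<^bold>: \<tau> \<and> free_for_tm s x r \<and> free_for_tm t x r
        \<and> subst_tm r s x = s' \<and> subst_tm r t x = t'"
    and "finite S"
  shows "\<Gamma> \<tturnstile> s' \<^bold>= t'"
proof -
  obtain x where x: "snd x = \<sigma>" "x \<notin> fv_tm s \<union> S"
    using fresh_var [of "fv_tm s \<union> S"] assms(4) by auto
  from assms(3) [OF this] obtain r where
    "r \<^bold>: \<tau>" "free_for_tm s x r" "free_for_tm t x r" "subst_tm r s x = s'" "subst_tm r t x = t'"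
    by blast
  then show ?thesis using eq_cong [OF assms(1), of x r \<tau>] assms(2) x by simp
qed

lemma app_cong_arg:
  assumes "\<Gamma> \<tturnstile> s \<^bold>= t" "s \<^bold>: \<sigma>" "f \<^bold>: \<sigma> \<^bold>\<Rightarrow> \<tau>"
  shows "\<Gamma> \<tturnstile> f \<^bold>\<cdot> s \<^bold>= f \<^bold>\<cdot> t"
proof (rule eq_cong_at [OF assms(1,2), where S = "fv_tm f"])
  fix x :: var
  assume "snd x = \<sigma>" "x \<notin> fv_tm s \<union> fv_tm f"
  then show "\<exists>r. r \<^bold>: \<tau> \<and> free_for_tm s x r \<and> free_for_tm t x r
      \<and> subst_tm r s x = f \<^bold>\<cdot> s \<and> subst_tm r t x = f \<^bold>\<cdot> t"
    using assms(3) by (intro exI [of _ "f \<^bold>\<cdot> Var x"]) auto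
qed simp

lemma app_cong_fun:
  assumes "\<Gamma> \<tturnstile> f \<^bold>= g" "f \<^bold>: \<sigma> \<^bold>\<Rightarrow> \<tau>" "t \<^bold>: \<sigma>"
  shows "\<Gamma> \<tturnstile> f \<^bold>\<cdot> t \<^bold>= g \<^bold>\<cdot> t"
proof (rule eq_cong_at [OF assms(1,2), where S = "fv_tm t"])
  fix x :: var
  assume "snd x = (\<sigma> \<^bold>\<Rightarrow> \<tau>)" "x \<notin> fv_tm f \<union> fv_tm t"
  then show "\<exists>r. r \<^bold>: \<tau> \<and> free_for_tm f x r \<and> free_for_tm g x r
      \<and> subst_tm r f x = f \<^bold>\<cdot> t \<and> subst_tm r g x = g \<^bold>\<cdot> t"
    using assms(3) by (intro exI [of _ "Var x \<^bold>\<cdot> t"]) auto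
qed simp

lemma Succ_cong:
  assumes "\<Gamma> \<tturnstile> s \<^bold>= t" "s \<^bold>: Nat"
  shows "\<Gamma> \<tturnstile> Succ s \<^bold>= Succ t"
proof (rule eq_cong_at [OF assms, where S = "{}"])
  fix x :: var
  assume "snd x = Nat" "x \<notin> fv_tm s \<union> {}"
  then show "\<exists>r. r \<^bold>: Nat \<and> free_for_tm s x r \<and> free_for_tm t x r
      \<and> subst_tm r s x = Succ s \<and> subst_tm r t x = Succ t"
    by (intro exI [of _ "Succ (Var x)"]) auto
qed simp

lemma pred_fun_closed [simp]: "fv_tm pred_fun = {}"
  by (auto simp: pred_fun_def)

lemma pred_fun_type [simp]: "pred_fun \<^bold>: \<tau> \<longleftrightarrow> \<tau> = (Nat \<^bold>\<Rightarrow> Nat)"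
  by (auto simp: pred_fun_def)

text \<open>
  The closed step function of the recursion neither captures nor contains variables, so
  \<open>monus\<close>, and with it the order, behaves under substitution like a primitive binary symbol and is
  not unfolded from here on.
\<close>

lemma monus_syntax [simp]:
  "fv_tm (monus s t) = fv_tm s \<union> fv_tm t"
  "subst_tm (monus s t) u x = monus (subst_tm s u x) (subst_tm t u x)"
  "free_for_tm u x (monus s t) \<longleftrightarrow> free_for_tm u x s \<and> free_for_tm u x t"
  "monus s t \<^bold>: \<tau> \<longleftrightarrow> \<tau> = Nat \<and> s \<^bold>: Nat \<and> t \<^bold>: Nat"
  by (auto simp: monus_def)

lemma Le_syntax [simp]:
  "fv (s \<^bold>\<le> t) = fv_tm s \<union> fv_tm t"
  "subst (s \<^bold>\<le> t) u x = (subst_tm s u x \<^bold>\<le> subst_tm t u x)"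
  "free_for u x (s \<^bold>\<le> t) \<longleftrightarrow> free_for_tm u x s \<and> free_for_tm u x t"
  "wf_fm (s \<^bold>\<le> t) \<longleftrightarrow> s \<^bold>: Nat \<and> t \<^bold>: Nat"
  by (auto simp: Le_def)

lemma Less_syntax [simp]:
  "fv (s \<^bold>< t) = fv_tm s \<union> fv_tm t"
  "subst (s \<^bold>< t) u x = (subst_tm s u x \<^bold>< subst_tm t u x)"
  "free_for u x (s \<^bold>< t) \<longleftrightarrow> free_for_tm u x s \<and> free_for_tm u x t"
  "wf_fm (s \<^bold>< t) \<longleftrightarrow> s \<^bold>: Nat \<and> t \<^bold>: Nat"
  by (auto simp: Less_def)

lemma monus_cong:
  assumes "\<Gamma> \<tturnstile> s \<^bold>= s'" "\<Gamma> \<tturnstile> t \<^bold>= t'" "s \<^bold>: Nat" "t \<^bold>: Nat"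
  shows "\<Gamma> \<tturnstile> monus s t \<^bold>= monus s' t'"
proof -
  have s': "s' \<^bold>: Nat"
    using seq_wf [OF assms(1)] assms(3) by (auto dest: has_type_unique)
  have "\<Gamma> \<tturnstile> monus s t \<^bold>= monus s' t"
  proof (rule eq_cong_at [OF assms(1,3), where S = "fv_tm t"])
    fix x :: var
    assume "snd x = Nat" "x \<notin> fv_tm s \<union> fv_tm t"
    then show "\<exists>r. r \<^bold>: Nat \<and> free_for_tm s x r \<and> free_for_tm s' x r
        \<and> subst_tm r s x = monus s t \<and> subst_tm r s' x = monus s' t"
      using assms by (intro exI [of _ "monus (Var x) t"]) auto
  qed simp
  also have "\<Gamma> \<tturnstile> monus s' t \<^bold>= monus s' t'"
  proof (rule eq_cong_at [OF assms(2,4), where S = "fv_tm s'"])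
    fix x :: var
    assume "snd x = Nat" "x \<notin> fv_tm t \<union> fv_tm s'"
    then show "\<exists>r. r \<^bold>: Nat \<and> free_for_tm t x r \<and> free_for_tm t' x r
        \<and> subst_tm r t x = monus s' t \<and> subst_tm r t' x = monus s' t'"
      using s' by (intro exI [of _ "monus s' (Var x)"]) auto
  qed simp
  finally show ?thesis .
qed

lemma pred_Zero: "wf_ctxt \<Gamma> \<Longrightarrow> \<Gamma> \<tturnstile> pred_fun \<^bold>\<cdot> Zero \<^bold>= Zero"
proof -
  assume wf: "wf_ctxt \<Gamma>"
  let ?b = "Lam (''y'', Nat) (Lam (''z'', Nat) (Var (''y'', Nat)))"
  have "{} \<^bold>\<turnstile> pred_fun \<^bold>\<cdot> Zero \<^bold>= subst_tm (Rec Zero ?b (Var (''x'', Nat))) Zero (''x'', Nat)"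
    unfolding pred_fun_def by (rule Beta [where \<tau> = Nat]) auto
  then have "\<Gamma> \<tturnstile> pred_fun \<^bold>\<cdot> Zero \<^bold>= Rec Zero ?b Zero"
    using wf by (intro seq_theorem) simp_all
  also have "\<Gamma> \<tturnstile> Rec Zero ?b Zero \<^bold>= Zero"
    by (rule seq_theorem [OF RecZero [where \<tau> = Nat] wf]) auto
  finally show ?thesis .
qed

text \<open>
  One of the beta reductions substitutes \<open>t\<close> below the binder \<open>z\<close> of \<open>pred_fun\<close>, and \<open>z\<close> may be
  free in \<open>t\<close>. The computation is therefore made for a variable \<open>w\<close>, and \<open>t\<close> is substituted only
  in the resulting equation, which has no binders around \<open>w\<close>.
\<close>

lemma pred_Succ:
  assumes wf: "wf_ctxt \<Gamma>" and "t \<^bold>: Nat"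
  shows "\<Gamma> \<tturnstile> pred_fun \<^bold>\<cdot> Succ t \<^bold>= t"
proof -
  let ?w = "(''w'', Nat)" and ?y = "(''y'', Nat)" and ?z = "(''z'', Nat)"
  let ?b = "Lam ?y (Lam ?z (Var ?y))"
  let ?r = "Rec Zero ?b (Var ?w)"
  have "{} \<^bold>\<turnstile> pred_fun \<^bold>\<cdot> Succ (Var ?w)
      \<^bold>= subst_tm (Rec Zero ?b (Var (''x'', Nat))) (Succ (Var ?w)) (''x'', Nat)"
    unfolding pred_fun_def by (rule Beta [where \<tau> = Nat]) auto
  then have "[] \<tturnstile> pred_fun \<^bold>\<cdot> Succ (Var ?w) \<^bold>= Rec Zero ?b (Succ (Var ?w))"
    by (simp add: seq_Nil)
  also have "[] \<tturnstile> Rec Zero ?b (Succ (Var ?w)) \<^bold>= ?b \<^bold>\<cdot> Var ?w \<^bold>\<cdot> ?r"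
    unfolding seq_Nil by (rule RecSucc [where \<tau> = Nat]) auto
  also have "[] \<tturnstile> ?b \<^bold>\<cdot> Var ?w \<^bold>\<cdot> ?r \<^bold>= Lam ?z (Var ?w) \<^bold>\<cdot> ?r"
  proof (rule app_cong_fun)
    have "{} \<^bold>\<turnstile> ?b \<^bold>\<cdot> Var ?w \<^bold>= subst_tm (Lam ?z (Var ?y)) (Var ?w) ?y"
      by (rule Beta) auto
    then show "[] \<tturnstile> ?b \<^bold>\<cdot> Var ?w \<^bold>= Lam ?z (Var ?w)"
      by (simp add: seq_Nil)
  qed auto
  also have "[] \<tturnstile> Lam ?z (Var ?w) \<^bold>\<cdot> ?r \<^bold>= Var ?w"
  proof -
    have "{} \<^bold>\<turnstile> Lam ?z (Var ?w) \<^bold>\<cdot> ?r \<^bold>= subst_tm (Var ?w) ?r ?z"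
      by (rule Beta) auto
    then show ?thesis by (simp add: seq_Nil)
  qed
  finally have "[] \<tturnstile> (\<^bold>\<forall>?w. pred_fun \<^bold>\<cdot> Succ (Var ?w) \<^bold>= Var ?w)"
    by (rule all_intro) simp
  then have "[] \<tturnstile> pred_fun \<^bold>\<cdot> Succ t \<^bold>= t"
    by (rule all_elim [where t = t]) (use assms in simp_all)
  then show ?thesis using wf by (simp add: seq_Nil seq_theorem)
qed

lemma monus_Zero: "wf_ctxt \<Gamma> \<Longrightarrow> s \<^bold>: Nat \<Longrightarrow> \<Gamma> \<tturnstile> monus s Zero \<^bold>= s"
  unfolding monus_def by (rule seq_theorem [OF RecZero [where \<tau> = Nat]]) auto

lemma monus_Succ:
  assumes "wf_ctxt \<Gamma>" "s \<^bold>: Nat" "t \<^bold>: Nat"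
  shows "\<Gamma> \<tturnstile> monus s (Succ t) \<^bold>= pred_fun \<^bold>\<cdot> monus s t"
proof -
  let ?b = "Lam (''y'', Nat) pred_fun"
  have "\<Gamma> \<tturnstile> monus s (Succ t) \<^bold>= ?b \<^bold>\<cdot> t \<^bold>\<cdot> monus s t"
    unfolding monus_def
    by (rule seq_theorem [OF RecSucc [where \<tau> = Nat]]) (use assms in auto)
  also have "\<Gamma> \<tturnstile> ?b \<^bold>\<cdot> t \<^bold>\<cdot> monus s t \<^bold>= pred_fun \<^bold>\<cdot> monus s t"
  proof (rule app_cong_fun)
    have "{} \<^bold>\<turnstile> ?b \<^bold>\<cdot> t \<^bold>= subst_tm pred_fun t (''y'', Nat)"
      by (rule Beta [where \<tau> = "Nat \<^bold>\<Rightarrow> Nat"]) (use assms in auto)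
    then show "\<Gamma> \<tturnstile> ?b \<^bold>\<cdot> t \<^bold>= pred_fun"
      using assms(1) by (simp add: seq_theorem)
  qed (use assms in auto)
  finally show ?thesis .
qed

text \<open>
  The equations \<open>0 - t = 0\<close> and \<open>(s + 1) - (t + 1) = s - t\<close> recurse on the first argument as well,
  although subtraction is defined by recursion on the second one. They make the
  order accessible to simultaneous induction on both arguments.
\<close>

lemma Zero_monus:
  assumes "wf_ctxt \<Gamma>" "t \<^bold>: Nat"
  shows "\<Gamma> \<tturnstile> monus Zero t \<^bold>= Zero"
proof -
  let ?x = "(''x'', Nat)"
  let ?A = "monus Zero (Var ?x) \<^bold>= Zero"
  have "[] \<tturnstile> subst ?A t ?x"
  proof (rule nat_induct_term)
    show "[] \<tturnstile> subst ?A Zero ?x" by (simp add: monus_Zero)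
    have "[?A] \<tturnstile> monus Zero (Succ (Var ?x)) \<^bold>= pred_fun \<^bold>\<cdot> monus Zero (Var ?x)"
      by (rule monus_Succ) auto
    also have "[?A] \<tturnstile> pred_fun \<^bold>\<cdot> monus Zero (Var ?x) \<^bold>= pred_fun \<^bold>\<cdot> Zero"
      by (rule app_cong_arg [OF hyp]) auto
    also have "[?A] \<tturnstile> pred_fun \<^bold>\<cdot> Zero \<^bold>= Zero"
      by (rule pred_Zero) auto
    finally show "[?A] \<tturnstile> subst ?A (Succ (Var ?x)) ?x" by simp
  qed (use assms in auto)
  then show ?thesis using assms by (simp add: seq_Nil seq_theorem)
qed

lemma Succ_monus_Succ:
  assumes "wf_ctxt \<Gamma>" "s \<^bold>: Nat" "t \<^bold>: Nat"
  shows "\<Gamma> \<tturnstile> monus (Succ s) (Succ t) \<^bold>= monus s t"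
proof -
  obtain x where x: "snd x = Nat" "x \<notin> fv_tm s" using fresh_var [of "fv_tm s"] by auto
  let ?A = "monus (Succ s) (Succ (Var x)) \<^bold>= monus s (Var x)"
  have "[] \<tturnstile> subst ?A t x"
  proof (rule nat_induct_term)
    have "[] \<tturnstile> monus (Succ s) (Succ Zero) \<^bold>= pred_fun \<^bold>\<cdot> monus (Succ s) Zero"
      by (rule monus_Succ) (use assms in auto)
    also have "[] \<tturnstile> pred_fun \<^bold>\<cdot> monus (Succ s) Zero \<^bold>= pred_fun \<^bold>\<cdot> Succ s"
      by (rule app_cong_arg [OF monus_Zero]) (use assms in auto)
    also have "[] \<tturnstile> pred_fun \<^bold>\<cdot> Succ s \<^bold>= s"
      by (rule pred_Succ) (use assms in auto)
    also have "[] \<tturnstile> s \<^bold>= monus s Zero"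
      by (rule eq_sym [OF monus_Zero]) (use assms in auto)
    finally show "[] \<tturnstile> subst ?A Zero x" using x by simp
    have "[?A] \<tturnstile> monus (Succ s) (Succ (Succ (Var x)))
        \<^bold>= pred_fun \<^bold>\<cdot> monus (Succ s) (Succ (Var x))"
      by (rule monus_Succ) (use assms x in auto)
    also have "[?A] \<tturnstile> pred_fun \<^bold>\<cdot> monus (Succ s) (Succ (Var x)) \<^bold>= pred_fun \<^bold>\<cdot> monus s (Var x)"
      by (rule app_cong_arg [OF hyp]) (use assms x in auto)
    also have "[?A] \<tturnstile> pred_fun \<^bold>\<cdot> monus s (Var x) \<^bold>= monus s (Succ (Var x))"
      by (rule eq_sym [OF monus_Succ]) (use assms x in auto)
    finally show "[?A] \<tturnstile> subst ?A (Succ (Var x)) x" using x by simp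
  qed (use assms x in auto)
  then show ?thesis using assms x by (simp add: seq_Nil seq_theorem)
qed

section \<open>The order on the natural numbers\<close>

lemma Succ_not_Zero: "\<Gamma> \<tturnstile> Succ t \<^bold>= Zero \<Longrightarrow> \<Gamma> \<tturnstile> \<^bold>\<bottom>"
  by (rule seq_rule1, rule SuccNotZero, rule Assm) (auto dest: seq_wf)

lemma Zero_le: "wf_ctxt \<Gamma> \<Longrightarrow> t \<^bold>: Nat \<Longrightarrow> \<Gamma> \<tturnstile> Zero \<^bold>\<le> t"
  unfolding Le_def by (rule Zero_monus)

lemma le_Zero: "\<Gamma> \<tturnstile> s \<^bold>\<le> Zero \<Longrightarrow> \<Gamma> \<tturnstile> s \<^bold>= Zero"
  using eq_trans [OF eq_sym [OF monus_Zero]] seq_wf seq_wf_ctxt by (fastforce simp: Le_def)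

lemma not_less_Zero: "\<Gamma> \<tturnstile> s \<^bold>< Zero \<Longrightarrow> \<Gamma> \<tturnstile> \<^bold>\<bottom>"
  unfolding Less_def by (drule le_Zero) (rule Succ_not_Zero)

lemma Succ_le_Succ_iff: "(\<Gamma> \<tturnstile> Succ s \<^bold>\<le> Succ t) \<longleftrightarrow> (\<Gamma> \<tturnstile> s \<^bold>\<le> t)"
proof
  assume *: "\<Gamma> \<tturnstile> Succ s \<^bold>\<le> Succ t"
  then have "s \<^bold>: Nat" "t \<^bold>: Nat" by (auto dest: seq_wf)
  from eq_sym [OF Succ_monus_Succ [OF seq_wf_ctxt [OF *] this]] * show "\<Gamma> \<tturnstile> s \<^bold>\<le> t"
    unfolding Le_def by (rule eq_trans)
next
  assume *: "\<Gamma> \<tturnstile> s \<^bold>\<le> t"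
  then have "s \<^bold>: Nat" "t \<^bold>: Nat" by (auto dest: seq_wf)
  from Succ_monus_Succ [OF seq_wf_ctxt [OF *] this] * show "\<Gamma> \<tturnstile> Succ s \<^bold>\<le> Succ t"
    unfolding Le_def by (rule eq_trans)
qed

lemma less_Succ_iff: "(\<Gamma> \<tturnstile> s \<^bold>< Succ t) \<longleftrightarrow> (\<Gamma> \<tturnstile> s \<^bold>\<le> t)"
  by (simp add: Less_def Succ_le_Succ_iff)

lemma le_SuccI:
  assumes "\<Gamma> \<tturnstile> s \<^bold>\<le> t"
  shows "\<Gamma> \<tturnstile> s \<^bold>\<le> Succ t"
proof -
  have wf: "wf_ctxt \<Gamma>" and type: "s \<^bold>: Nat" "t \<^bold>: Nat"
    using seq_wf_ctxt [OF assms] seq_wf [OF assms] by auto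
  note monus_Succ [OF wf type]
  also have "\<Gamma> \<tturnstile> pred_fun \<^bold>\<cdot> monus s t \<^bold>= pred_fun \<^bold>\<cdot> Zero"
    by (rule app_cong_arg) (use assms type in \<open>auto simp: Le_def\<close>)
  also note pred_Zero [OF wf]
  finally show ?thesis unfolding Le_def .
qed

lemma less_imp_le: "\<Gamma> \<tturnstile> s \<^bold>< t \<Longrightarrow> \<Gamma> \<tturnstile> s \<^bold>\<le> t"
  unfolding Less_def by (drule le_SuccI) (simp add: Succ_le_Succ_iff)

lemma le_refl:
  assumes "wf_ctxt \<Gamma>" "t \<^bold>: Nat"
  shows "\<Gamma> \<tturnstile> t \<^bold>\<le> t"
proof -
  let ?x = "(''x'', Nat)"
  let ?A = "Var ?x \<^bold>\<le> Var ?x"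
  have "[] \<tturnstile> subst ?A t ?x"
  proof (rule nat_induct_term)
    show "[] \<tturnstile> subst ?A Zero ?x" by (simp add: Zero_le)
    show "[?A] \<tturnstile> subst ?A (Succ (Var ?x)) ?x" by (simp add: Succ_le_Succ_iff hyp)
  qed (use assms in auto)
  then show ?thesis using assms by (simp add: seq_Nil seq_theorem)
qed

lemma le_cong:
  assumes "\<Gamma> \<tturnstile> s \<^bold>\<le> t" "\<Gamma> \<tturnstile> s' \<^bold>= s" "\<Gamma> \<tturnstile> t' \<^bold>= t"
  shows "\<Gamma> \<tturnstile> s' \<^bold>\<le> t'"
proof -
  have "s' \<^bold>: Nat" "t' \<^bold>: Nat"
    using assms [THEN seq_wf] by (auto dest: has_type_unique)
  from monus_cong [OF assms(2,3) this] assms(1) show ?thesis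
    unfolding Le_def by (rule eq_trans)
qed

lemma less_cong:
  assumes "\<Gamma> \<tturnstile> s \<^bold>< t" "\<Gamma> \<tturnstile> s' \<^bold>= s" "\<Gamma> \<tturnstile> t' \<^bold>= t"
  shows "\<Gamma> \<tturnstile> s' \<^bold>< t'"
proof -
  have "s' \<^bold>: Nat"
    using assms [THEN seq_wf] by (auto dest: has_type_unique)
  then show ?thesis
    using assms unfolding Less_def by (intro le_cong [OF assms(1) [unfolded Less_def]] Succ_cong)
qed

text \<open>
  Induction on \<open>x\<close> for the statement quantified over \<open>y\<close>. The inner induction on \<open>y\<close> serves only to
  distinguish zero from successors: its step applies the outer hypothesis \<open>\<forall>y. A\<close>.
\<close>

lemma nat_double_induct:
  assumes zero: "[] \<tturnstile> subst A Zero x"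
    and succ_zero: "[] \<tturnstile> subst (subst A (Succ (Var x)) x) Zero y"
    and succ_succ: "[A] \<tturnstile> subst (subst A (Succ (Var x)) x) (Succ (Var y)) y"
    and xy: "snd x = Nat" "snd y = Nat" "x \<noteq> y"
  shows "[] \<tturnstile> (\<^bold>\<forall>x. \<^bold>\<forall>y. A)"
proof (rule nat_induct_rule)
  show "[] \<tturnstile> subst (\<^bold>\<forall>y. A) Zero x"
    using zero xy by (auto intro: all_intro)
  have wf: "wf_fm A"
    using seq_wf_ctxt [OF succ_succ] by simp
  let ?S = "subst A (Succ (Var x)) x"
  have wfS: "wf_fm ?S"
    using wf xy by (intro wf_fm_subst) auto
  have "[\<^bold>\<forall>y. A] \<tturnstile> (\<^bold>\<forall>y. ?S)"
  proof (rule nat_induct_rule)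
    show "[\<^bold>\<forall>y. A] \<tturnstile> subst ?S Zero y"
      using succ_zero wf by (intro seq_weaken) auto
    have "[?S, \<^bold>\<forall>y. A] \<tturnstile> (\<^bold>\<forall>y. A)"
      using wf wfS by (intro hyp) auto
    then have "[?S, \<^bold>\<forall>y. A] \<tturnstile> A"
      by (rule all_elim [where t = "Var y"]) auto
    moreover have "[?S, \<^bold>\<forall>y. A] \<tturnstile> A \<^bold>\<longrightarrow> subst ?S (Succ (Var y)) y"
      using succ_succ wf wfS by (intro seq_weaken) (auto simp: seq_Cons)
    ultimately show "[?S, \<^bold>\<forall>y. A] \<tturnstile> subst ?S (Succ (Var y)) y"
      by (rule imp_elim [rotated])
  qed (use xy in auto)
  then show "[\<^bold>\<forall>y. A] \<tturnstile> subst (\<^bold>\<forall>y. A) (Succ (Var x)) x"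
    using xy by simp
qed (use xy in auto)

lemma all2_elim:
  assumes "[] \<tturnstile> (\<^bold>\<forall>x. \<^bold>\<forall>y. A)" "wf_ctxt \<Gamma>" "s \<^bold>: snd x" "t \<^bold>: snd y"
    and "x \<noteq> y" "y \<notin> fv_tm s" "free_for s x A" "free_for t y (subst A s x)"
  shows "\<Gamma> \<tturnstile> subst (subst A s x) t y"
proof -
  have "[] \<tturnstile> (\<^bold>\<forall>y. subst A s x)"
    by (rule all_elim [OF assms(1,3)]) (use assms in auto)
  then have "[] \<tturnstile> subst (subst A s x) t y"
    by (rule all_elim) (use assms in auto)
  then show ?thesis
    using assms(2) by (simp add: seq_Nil seq_theorem)
qed

lemma fresh_var_pair:
  assumes "finite S"
  obtains x y :: var where "snd x = \<tau>" "snd y = \<tau>" "x \<noteq> y" "x \<notin> S" "y \<notin> S"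
  by (metis assms finite_insert fresh_var insertCI)

lemma le_cases:
  assumes "\<Gamma> \<tturnstile> s \<^bold>\<le> t"
  shows "\<Gamma> \<tturnstile> s \<^bold>= t \<^bold>\<or> s \<^bold>< t"
proof -
  have type: "s \<^bold>: Nat" "t \<^bold>: Nat" using seq_wf [OF assms] by auto
  obtain x y where xy: "snd x = Nat" "snd y = Nat" "x \<noteq> y"
      "x \<notin> fv_tm s \<union> fv_tm t" "y \<notin> fv_tm s \<union> fv_tm t"
    by (rule fresh_var_pair [of "fv_tm s \<union> fv_tm t" Nat]) simp
  let ?B = "Var x \<^bold>= Var y \<^bold>\<or> Var x \<^bold>< Var y"
  let ?A = "Var x \<^bold>\<le> Var y \<^bold>\<longrightarrow> ?B"
  have "[] \<tturnstile> (\<^bold>\<forall>x. \<^bold>\<forall>y. ?A)"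
  proof (rule nat_double_induct)
    let ?C = "subst ?B Zero x"
    have "[] \<tturnstile> subst ?C (Var y) y"
    proof (rule nat_induct_term)
      show "[] \<tturnstile> subst ?C Zero y"
        using xy by (auto intro!: or_intro1 eq_refl)
      show "[?C] \<tturnstile> subst ?C (Succ (Var y)) y"
        using xy by (auto intro!: or_intro2 Zero_le simp: less_Succ_iff)
    qed (use xy in auto)
    then have "[Zero \<^bold>\<le> Var y] \<tturnstile> ?C"
      using xy by (intro seq_weaken) auto
    then show "[] \<tturnstile> subst ?A Zero x"
      using xy by (simp add: seq_Cons)
  next
    have "[Succ (Var x) \<^bold>\<le> Zero] \<tturnstile> \<^bold>\<bottom>"
      by (rule Succ_not_Zero [OF le_Zero [OF hyp]]) (use xy in auto)
    then have "[Succ (Var x) \<^bold>\<le> Zero] \<tturnstile> subst (subst ?B (Succ (Var x)) x) Zero y"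
      by (rule bot_elim) (use xy in auto)
    then show "[] \<tturnstile> subst (subst ?A (Succ (Var x)) x) Zero y"
      using xy by (simp add: seq_Cons)
  next
    let ?G = "[Succ (Var x) \<^bold>\<le> Succ (Var y), ?A]"
    have "?G \<tturnstile> ?B"
    proof (rule imp_elim)
      show "?G \<tturnstile> ?A" by (rule hyp) (use xy in auto)
      have "?G \<tturnstile> Succ (Var x) \<^bold>\<le> Succ (Var y)" by (rule hyp) (use xy in auto)
      then show "?G \<tturnstile> Var x \<^bold>\<le> Var y" by (simp add: Succ_le_Succ_iff)
    qed
    then have "?G \<tturnstile> Succ (Var x) \<^bold>= Succ (Var y) \<^bold>\<or> Succ (Var x) \<^bold>< Succ (Var y)"
    proof (rule or_elim)
      show "(Var x \<^bold>= Var y) # ?G \<tturnstile> Succ (Var x) \<^bold>= Succ (Var y) \<^bold>\<or> Succ (Var x) \<^bold>< Succ (Var y)"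
        by (intro or_intro1 Succ_cong hyp) (use xy in auto)
      have "(Var x \<^bold>< Var y) # ?G \<tturnstile> Var x \<^bold>< Var y" by (rule hyp) (use xy in auto)
      then show "(Var x \<^bold>< Var y) # ?G \<tturnstile> Succ (Var x) \<^bold>= Succ (Var y) \<^bold>\<or> Succ (Var x) \<^bold>< Succ (Var y)"
        by (intro or_intro2) (use xy in \<open>auto simp: Less_def Succ_le_Succ_iff\<close>)
    qed
    then show "[?A] \<tturnstile> subst (subst ?A (Succ (Var x)) x) (Succ (Var y)) y"
      using xy by (simp add: seq_Cons)
  qed (use xy in auto)
  then have "\<Gamma> \<tturnstile> subst (subst ?A s x) t y"
    by (rule all2_elim) (use xy type seq_wf_ctxt [OF assms] in auto)
  then have "\<Gamma> \<tturnstile> s \<^bold>\<le> t \<^bold>\<longrightarrow> s \<^bold>= t \<^bold>\<or> s \<^bold>< t"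
    using xy by simp
  then show ?thesis using assms by (rule imp_elim)
qed

lemma le_or_less:
  assumes "wf_ctxt \<Gamma>" "s \<^bold>: Nat" "t \<^bold>: Nat"
  shows "\<Gamma> \<tturnstile> s \<^bold>\<le> t \<^bold>\<or> t \<^bold>< s"
proof -
  obtain x y where xy: "snd x = Nat" "snd y = Nat" "x \<noteq> y"
      "x \<notin> fv_tm s \<union> fv_tm t" "y \<notin> fv_tm s \<union> fv_tm t"
    by (rule fresh_var_pair [of "fv_tm s \<union> fv_tm t" Nat]) simp
  let ?A = "Var x \<^bold>\<le> Var y \<^bold>\<or> Var y \<^bold>< Var x"
  have "[] \<tturnstile> (\<^bold>\<forall>x. \<^bold>\<forall>y. ?A)"
  proof (rule nat_double_induct)
    show "[] \<tturnstile> subst ?A Zero x"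
      using xy by (auto intro!: or_intro1 Zero_le)
    show "[] \<tturnstile> subst (subst ?A (Succ (Var x)) x) Zero y"
      using xy by (auto intro!: or_intro2 Zero_le simp: less_Succ_iff)
    have "[?A] \<tturnstile> ?A" by (rule hyp) (use xy in auto)
    then have "[?A] \<tturnstile> Succ (Var x) \<^bold>\<le> Succ (Var y) \<^bold>\<or> Succ (Var y) \<^bold>< Succ (Var x)"
    proof (rule or_elim)
      have "[Var x \<^bold>\<le> Var y, ?A] \<tturnstile> Var x \<^bold>\<le> Var y" by (rule hyp) (use xy in auto)
      then show "[Var x \<^bold>\<le> Var y, ?A] \<tturnstile> Succ (Var x) \<^bold>\<le> Succ (Var y) \<^bold>\<or> Succ (Var y) \<^bold>< Succ (Var x)"
        by (intro or_intro1) (use xy in \<open>auto simp: Succ_le_Succ_iff\<close>)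
      have "[Var y \<^bold>< Var x, ?A] \<tturnstile> Var y \<^bold>< Var x" by (rule hyp) (use xy in auto)
      then show "[Var y \<^bold>< Var x, ?A] \<tturnstile> Succ (Var x) \<^bold>\<le> Succ (Var y) \<^bold>\<or> Succ (Var y) \<^bold>< Succ (Var x)"
        by (intro or_intro2) (use xy in \<open>auto simp: Less_def Succ_le_Succ_iff\<close>)
    qed
    then show "[?A] \<tturnstile> subst (subst ?A (Succ (Var x)) x) (Succ (Var y)) y"
      using xy by simp
  qed (use xy in auto)
  then have "\<Gamma> \<tturnstile> subst (subst ?A s x) t y"
    by (rule all2_elim) (use xy assms in auto)
  then show ?thesis using xy by simp
qed

text \<open>
  By induction on \<open>u\<close>: if \<open>t \<le> u + 1\<close>, then \<open>t\<close> is \<open>u + 1\<close> or \<open>t \<le> u\<close>.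
\<close>

lemma le_trans:
  assumes "\<Gamma> \<tturnstile> s \<^bold>\<le> t" "\<Gamma> \<tturnstile> t \<^bold>\<le> u"
  shows "\<Gamma> \<tturnstile> s \<^bold>\<le> u"
proof -
  have type: "s \<^bold>: Nat" "t \<^bold>: Nat" "u \<^bold>: Nat"
    using assms [THEN seq_wf] by auto
  obtain x where x: "snd x = Nat" "x \<notin> fv_tm s \<union> fv_tm t"
    using fresh_var [of "fv_tm s \<union> fv_tm t"] by auto
  let ?A = "t \<^bold>\<le> Var x \<^bold>\<longrightarrow> s \<^bold>\<le> Var x"
  have "[s \<^bold>\<le> t] \<tturnstile> subst ?A u x"
  proof (rule nat_induct_term)
    let ?G = "[t \<^bold>\<le> Zero, s \<^bold>\<le> t]"
    have "?G \<tturnstile> s \<^bold>\<le> t" by (rule hyp) (use type in auto)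
    then have "?G \<tturnstile> s \<^bold>\<le> Zero"
      by (rule le_cong [OF _ eq_refl eq_sym [OF le_Zero [OF hyp]]]) (use type in auto)
    then show "[s \<^bold>\<le> t] \<tturnstile> subst ?A Zero x" using x by (simp add: seq_Cons)
  next
    let ?G = "[t \<^bold>\<le> Succ (Var x), ?A, s \<^bold>\<le> t]"
    have "?G \<tturnstile> t \<^bold>= Succ (Var x) \<^bold>\<or> t \<^bold>< Succ (Var x)"
      by (rule le_cases [OF hyp]) (use type x in auto)
    then have "?G \<tturnstile> s \<^bold>\<le> Succ (Var x)"
    proof (rule or_elim)
      let ?G1 = "(t \<^bold>= Succ (Var x)) # ?G"
      have "?G1 \<tturnstile> s \<^bold>\<le> t" by (rule hyp) (use type x in auto)
      then show "?G1 \<tturnstile> s \<^bold>\<le> Succ (Var x)"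
        by (rule le_cong [OF _ eq_refl eq_sym [OF hyp]]) (use type x in auto)
      let ?G2 = "(t \<^bold>< Succ (Var x)) # ?G"
      have "?G2 \<tturnstile> t \<^bold>< Succ (Var x)" "?G2 \<tturnstile> ?A"
        by (rule hyp; use type x in auto)+
      then have "?G2 \<tturnstile> s \<^bold>\<le> Var x"
        unfolding less_Succ_iff by (rule imp_elim [rotated])
      then show "?G2 \<tturnstile> s \<^bold>\<le> Succ (Var x)"
        by (rule le_SuccI)
    qed
    then show "[?A, s \<^bold>\<le> t] \<tturnstile> subst ?A (Succ (Var x)) x"
      using x by (simp add: seq_Cons)
  qed (use x type in auto)
  then have "[] \<tturnstile> s \<^bold>\<le> t \<^bold>\<longrightarrow> t \<^bold>\<le> u \<^bold>\<longrightarrow> s \<^bold>\<le> u"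
    using x by (simp add: seq_Cons)
  then have "\<Gamma> \<tturnstile> s \<^bold>\<le> t \<^bold>\<longrightarrow> t \<^bold>\<le> u \<^bold>\<longrightarrow> s \<^bold>\<le> u"
    using seq_wf_ctxt [OF assms(1)] by (simp add: seq_Nil seq_theorem)
  then show ?thesis
    using assms by (rule imp_elim [OF imp_elim])
qed

lemma less_le_trans: "\<Gamma> \<tturnstile> s \<^bold>< t \<Longrightarrow> \<Gamma> \<tturnstile> t \<^bold>\<le> u \<Longrightarrow> \<Gamma> \<tturnstile> s \<^bold>< u"
  unfolding Less_def by (rule le_trans)

lemma le_less_trans: "\<Gamma> \<tturnstile> s \<^bold>\<le> t \<Longrightarrow> \<Gamma> \<tturnstile> t \<^bold>< u \<Longrightarrow> \<Gamma> \<tturnstile> s \<^bold>< u"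
  unfolding Less_def by (rule le_trans [of _ _ "Succ t"]) (simp_all add: Succ_le_Succ_iff)

section \<open>Deciding arithmetical predicates by LPO\<close>

text \<open>
  The term \<open>1 - t\<close> is the characteristic function of \<open>t = 0\<close>, and \<open>(1 - s) - t\<close> is that of
  \<open>s = 0 \<and> t = 0\<close>. As the order is given by equations \<open>s - t = 0\<close>, the second one covers
  conjunctions of two inequalities.
\<close>

lemma Zero_cases:
  assumes "wf_ctxt \<Gamma>" "t \<^bold>: Nat"
  shows "\<Gamma> \<tturnstile> (monus (Succ Zero) t \<^bold>= Succ Zero \<^bold>\<and> t \<^bold>= Zero)
    \<^bold>\<or> (monus (Succ Zero) t \<^bold>= Zero \<^bold>\<and> (t \<^bold>= Zero \<^bold>\<longrightarrow> \<^bold>\<bottom>))"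
proof -
  let ?x = "(''x'', Nat)"
  let ?A = "(monus (Succ Zero) (Var ?x) \<^bold>= Succ Zero \<^bold>\<and> Var ?x \<^bold>= Zero)
    \<^bold>\<or> (monus (Succ Zero) (Var ?x) \<^bold>= Zero \<^bold>\<and> (Var ?x \<^bold>= Zero \<^bold>\<longrightarrow> \<^bold>\<bottom>))"
  have "[] \<tturnstile> subst ?A t ?x"
  proof (rule nat_induct_term)
    show "[] \<tturnstile> subst ?A Zero ?x"
      by (auto intro!: or_intro1 and_intro monus_Zero eq_refl)
    have "[?A] \<tturnstile> monus (Succ Zero) (Succ (Var ?x)) \<^bold>= monus Zero (Var ?x)"
      by (rule Succ_monus_Succ) auto
    also have "[?A] \<tturnstile> monus Zero (Var ?x) \<^bold>= Zero"
      by (rule Zero_monus) auto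
    finally have "[?A] \<tturnstile> monus (Succ Zero) (Succ (Var ?x)) \<^bold>= Zero" .
    moreover have "[?A] \<tturnstile> Succ (Var ?x) \<^bold>= Zero \<^bold>\<longrightarrow> \<^bold>\<bottom>"
      by (rule imp_intro, rule Succ_not_Zero [OF hyp]) auto
    ultimately show "[?A] \<tturnstile> subst ?A (Succ (Var ?x)) ?x"
      by (simp add: or_intro2 and_intro)
  qed (use assms in auto)
  then have "[] \<tturnstile> (monus (Succ Zero) t \<^bold>= Succ Zero \<^bold>\<and> t \<^bold>= Zero)
    \<^bold>\<or> (monus (Succ Zero) t \<^bold>= Zero \<^bold>\<and> (t \<^bold>= Zero \<^bold>\<longrightarrow> \<^bold>\<bottom>))" by simp
  then show ?thesis using assms(1) unfolding seq_Nil by (rule seq_theorem)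
qed

abbreviation both_zero :: "tm \<Rightarrow> tm \<Rightarrow> tm" where
  "both_zero s t \<equiv> monus (monus (Succ Zero) s) t"

lemma both_zero_cases:
  assumes "wf_ctxt \<Gamma>" "s \<^bold>: Nat" "t \<^bold>: Nat"
  shows "\<Gamma> \<tturnstile> (both_zero s t \<^bold>= Succ Zero \<^bold>\<and> s \<^bold>= Zero \<^bold>\<and> t \<^bold>= Zero)
    \<^bold>\<or> (both_zero s t \<^bold>= Zero \<^bold>\<and> (s \<^bold>= Zero \<^bold>\<longrightarrow> t \<^bold>= Zero \<^bold>\<longrightarrow> \<^bold>\<bottom>))"
    (is "\<Gamma> \<tturnstile> ?P \<^bold>\<or> ?Q")
proof (rule or_elim [OF Zero_cases [OF assms(1,2)]])
  let ?S = "monus (Succ Zero) s \<^bold>= Succ Zero \<^bold>\<and> s \<^bold>= Zero"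
  let ?\<Gamma> = "?S # \<Gamma>"
  have wf: "wf_ctxt ?\<Gamma>" using assms by auto
  show "?\<Gamma> \<tturnstile> ?P \<^bold>\<or> ?Q"
  proof (rule or_elim [OF Zero_cases [OF wf assms(3)]])
    let ?T = "monus (Succ Zero) t \<^bold>= Succ Zero \<^bold>\<and> t \<^bold>= Zero"
    let ?\<Delta> = "?T # ?\<Gamma>"
    have S: "?\<Delta> \<tturnstile> ?S" and T: "?\<Delta> \<tturnstile> ?T" by (rule hyp; use assms in auto)+
    have "?\<Delta> \<tturnstile> both_zero s t \<^bold>= monus (Succ Zero) t"
      by (rule monus_cong [OF and_elim1 [OF S] eq_refl]) (use assms in auto)
    also note and_elim1 [OF T]
    finally have "?\<Delta> \<tturnstile> ?P"
      by (intro and_intro and_elim2 [OF S] and_elim2 [OF T])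
    then show "?\<Delta> \<tturnstile> ?P \<^bold>\<or> ?Q"
      by (rule or_intro1) (use assms in auto)
  next
    let ?T = "monus (Succ Zero) t \<^bold>= Zero \<^bold>\<and> (t \<^bold>= Zero \<^bold>\<longrightarrow> \<^bold>\<bottom>)"
    let ?\<Delta> = "?T # ?\<Gamma>"
    have S: "?\<Delta> \<tturnstile> ?S" and T: "?\<Delta> \<tturnstile> ?T" by (rule hyp; use assms in auto)+
    have "?\<Delta> \<tturnstile> both_zero s t \<^bold>= monus (Succ Zero) t"
      by (rule monus_cong [OF and_elim1 [OF S] eq_refl]) (use assms in auto)
    also note and_elim1 [OF T]
    finally have "?\<Delta> \<tturnstile> both_zero s t \<^bold>= Zero" .
    moreover have "?\<Delta> \<tturnstile> s \<^bold>= Zero \<^bold>\<longrightarrow> t \<^bold>= Zero \<^bold>\<longrightarrow> \<^bold>\<bottom>"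
      by (rule imp_intro, rule seq_weaken [OF and_elim2 [OF T]]) (use assms in auto)
    ultimately show "?\<Delta> \<tturnstile> ?P \<^bold>\<or> ?Q"
      by (intro or_intro2 and_intro) (use assms in auto)
  qed
next
  let ?S = "monus (Succ Zero) s \<^bold>= Zero \<^bold>\<and> (s \<^bold>= Zero \<^bold>\<longrightarrow> \<^bold>\<bottom>)"
  let ?\<Gamma> = "?S # \<Gamma>"
  have S: "?\<Gamma> \<tturnstile> ?S" by (rule hyp) (use assms in auto)
  have "?\<Gamma> \<tturnstile> both_zero s t \<^bold>= monus Zero t"
    by (rule monus_cong [OF and_elim1 [OF S] eq_refl]) (use assms in auto)
  also have "?\<Gamma> \<tturnstile> monus Zero t \<^bold>= Zero"
    by (rule Zero_monus) (use assms in auto)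
  finally have "?\<Gamma> \<tturnstile> both_zero s t \<^bold>= Zero" .
  moreover have "?\<Gamma> \<tturnstile> s \<^bold>= Zero \<^bold>\<longrightarrow> t \<^bold>= Zero \<^bold>\<longrightarrow> \<^bold>\<bottom>"
  proof (rule imp_intro, rule imp_intro)
    have "(s \<^bold>= Zero) # ?\<Gamma> \<tturnstile> \<^bold>\<bottom>"
      by (rule imp_elim [OF seq_weaken [OF and_elim2 [OF S]] hyp]) (use assms in auto)
    then show "(t \<^bold>= Zero) # (s \<^bold>= Zero) # ?\<Gamma> \<tturnstile> \<^bold>\<bottom>"
      by (rule seq_weaken) (use assms in auto)
  qed
  ultimately show "?\<Gamma> \<tturnstile> ?P \<^bold>\<or> ?Q"
    by (intro or_intro2 and_intro) (use assms in auto)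
qed

lemma wf_LPO [simp]: "wf_fm LPO"
  by (auto simp: LPO_def Let_def)

lemma LPO_closed [simp]: "fv LPO = {}"
  by (auto simp: LPO_def Let_def)

text \<open>
  LPO for the binary sequence \<open>\<lambda>n. (1 - s) - t\<close>, where \<open>n\<close> may occur in \<open>s\<close> and \<open>t\<close>. The name of
  \<open>n\<close> is the one bound in LPO, so the quantifiers of the instance are already in the required form.
\<close>

lemma LPO_decides:
  defines "n \<equiv> (''n'', Nat)"
  assumes lpo: "\<Gamma> \<tturnstile> LPO" and type: "s \<^bold>: Nat" "t \<^bold>: Nat" and fresh: "\<forall>B\<in>set \<Gamma>. n \<notin> fv B"
  shows "\<Gamma> \<tturnstile> (\<^bold>\<exists>n. s \<^bold>= Zero \<^bold>\<and> t \<^bold>= Zero) \<^bold>\<or> (\<^bold>\<forall>n. s \<^bold>= Zero \<^bold>\<longrightarrow> t \<^bold>= Zero \<^bold>\<longrightarrow> \<^bold>\<bottom>)"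
    (is "\<Gamma> \<tturnstile> ?E \<^bold>\<or> ?U")
proof -
  let ?\<beta> = "Lam n (both_zero s t)"
  let ?\<beta>n = "?\<beta> \<^bold>\<cdot> Var n"
  let ?P = "both_zero s t \<^bold>= Succ Zero \<^bold>\<and> s \<^bold>= Zero \<^bold>\<and> t \<^bold>= Zero"
  let ?Q = "both_zero s t \<^bold>= Zero \<^bold>\<and> (s \<^bold>= Zero \<^bold>\<longrightarrow> t \<^bold>= Zero \<^bold>\<longrightarrow> \<^bold>\<bottom>)"
  have n: "snd n = Nat" by (simp add: n_def)
  have wf: "wf_ctxt \<Gamma>" using lpo by (rule seq_wf_ctxt)
  have beta: "\<Delta> \<tturnstile> ?\<beta>n \<^bold>= both_zero s t" if "wf_ctxt \<Delta>" for \<Delta>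
  proof -
    have "{} \<^bold>\<turnstile> ?\<beta>n \<^bold>= subst_tm (both_zero s t) (Var n) n"
      by (rule Beta [where \<tau> = Nat]) (use type n in auto)
    then show ?thesis using that by (simp add: seq_theorem)
  qed
  have "\<Gamma> \<tturnstile> ?\<beta>n \<^bold>= Zero \<^bold>\<or> ?\<beta>n \<^bold>= Succ Zero"
  proof (rule or_elim [OF both_zero_cases [OF wf type]])
    have "?P # \<Gamma> \<tturnstile> ?P" by (rule hyp) (use type wf in auto)
    then have "?P # \<Gamma> \<tturnstile> ?\<beta>n \<^bold>= Succ Zero"
      by (rule eq_trans [OF beta and_elim1, rotated]) (use type wf in auto)
    then show "?P # \<Gamma> \<tturnstile> ?\<beta>n \<^bold>= Zero \<^bold>\<or> ?\<beta>n \<^bold>= Succ Zero"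
      by (rule or_intro2) (use type n in auto)
    have "?Q # \<Gamma> \<tturnstile> ?Q" by (rule hyp) (use type wf in auto)
    then have "?Q # \<Gamma> \<tturnstile> ?\<beta>n \<^bold>= Zero"
      by (rule eq_trans [OF beta and_elim1, rotated]) (use type wf in auto)
    then show "?Q # \<Gamma> \<tturnstile> ?\<beta>n \<^bold>= Zero \<^bold>\<or> ?\<beta>n \<^bold>= Succ Zero"
      by (rule or_intro1) (use type n in auto)
  qed
  then have "\<Gamma> \<tturnstile> (\<^bold>\<forall>n. ?\<beta>n \<^bold>= Zero \<^bold>\<or> ?\<beta>n \<^bold>= Succ Zero)"
    using fresh by (rule all_intro)
  moreover have "\<Gamma> \<tturnstile> (\<^bold>\<forall>n. ?\<beta>n \<^bold>= Zero \<^bold>\<or> ?\<beta>n \<^bold>= Succ Zero)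
      \<^bold>\<longrightarrow> (\<^bold>\<exists>n. ?\<beta>n \<^bold>= Succ Zero) \<^bold>\<or> (\<^bold>\<forall>n. ?\<beta>n \<^bold>= Zero)"
    using lpo [unfolded LPO_def Let_def]
    by (rule all_elim [where t = ?\<beta>]) (use type in \<open>auto simp: n_def\<close>)
  ultimately have "\<Gamma> \<tturnstile> (\<^bold>\<exists>n. ?\<beta>n \<^bold>= Succ Zero) \<^bold>\<or> (\<^bold>\<forall>n. ?\<beta>n \<^bold>= Zero)"
    by (rule imp_elim [rotated])
  then show ?thesis
  proof (rule or_elim)
    let ?X = "\<^bold>\<exists>n. ?\<beta>n \<^bold>= Succ Zero"
    let ?\<Delta> = "(?\<beta>n \<^bold>= Succ Zero) # ?X # \<Gamma>"
    have wf': "wf_ctxt (?X # \<Gamma>)" "wf_ctxt ?\<Delta>" "wf_ctxt (?P # ?\<Delta>)" "wf_ctxt (?Q # ?\<Delta>)"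
      using wf type n by auto
    have "?X # \<Gamma> \<tturnstile> ?E"
    proof (rule ex_elim [OF hyp [OF _ wf'(1)]])
      show "?\<Delta> \<tturnstile> ?E"
      proof (rule or_elim [OF both_zero_cases [OF wf'(2) type]])
        have "?P # ?\<Delta> \<tturnstile> s \<^bold>= Zero \<^bold>\<and> t \<^bold>= Zero"
          by (rule and_elim2 [OF hyp]) (use wf' in auto)
        then show "?P # ?\<Delta> \<tturnstile> ?E"
          by (intro ex_intro [where t = "Var n"]) (use type in auto)
        have "?Q # ?\<Delta> \<tturnstile> Succ Zero \<^bold>= ?\<beta>n"
          by (rule eq_sym [OF hyp]) (use wf' in auto)
        also note beta [OF wf'(4)]
        also have "?Q # ?\<Delta> \<tturnstile> both_zero s t \<^bold>= Zero"
          by (rule and_elim1 [OF hyp]) (use wf' in auto)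
        finally show "?Q # ?\<Delta> \<tturnstile> ?E"
          by (rule bot_elim [OF Succ_not_Zero]) (use type in auto)
      qed
    qed (use fresh in auto)
    then show "?X # \<Gamma> \<tturnstile> ?E \<^bold>\<or> ?U"
      by (rule or_intro1) (use type in auto)
  next
    let ?Y = "\<^bold>\<forall>n. ?\<beta>n \<^bold>= Zero"
    have wf': "wf_ctxt (?Y # \<Gamma>)" "wf_ctxt (?P # ?Y # \<Gamma>)" "wf_ctxt (?Q # ?Y # \<Gamma>)"
      using wf type n by auto
    have "?Y # \<Gamma> \<tturnstile> ?U"
    proof (rule all_intro)
      show "?Y # \<Gamma> \<tturnstile> s \<^bold>= Zero \<^bold>\<longrightarrow> t \<^bold>= Zero \<^bold>\<longrightarrow> \<^bold>\<bottom>"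
      proof (rule or_elim [OF both_zero_cases [OF wf'(1) type]])
        have "?P # ?Y # \<Gamma> \<tturnstile> ?Y" by (rule hyp) (use wf' in auto)
        then have Y: "?P # ?Y # \<Gamma> \<tturnstile> ?\<beta>n \<^bold>= Zero"
          by (rule all_elim [where t = "Var n"]) auto
        have "?P # ?Y # \<Gamma> \<tturnstile> Succ Zero \<^bold>= both_zero s t"
          by (rule eq_sym [OF and_elim1 [OF hyp]]) (use wf' in auto)
        also note eq_sym [OF beta [OF wf'(2)]]
        also note Y
        finally show "?P # ?Y # \<Gamma> \<tturnstile> s \<^bold>= Zero \<^bold>\<longrightarrow> t \<^bold>= Zero \<^bold>\<longrightarrow> \<^bold>\<bottom>"
          by (rule bot_elim [OF Succ_not_Zero]) (use type in auto)
        show "?Q # ?Y # \<Gamma> \<tturnstile> s \<^bold>= Zero \<^bold>\<longrightarrow> t \<^bold>= Zero \<^bold>\<longrightarrow> \<^bold>\<bottom>"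
          by (rule and_elim2 [OF hyp]) (use wf' in auto)
      qed
    qed (use fresh in auto)
    then show "?Y # \<Gamma> \<tturnstile> ?E \<^bold>\<or> ?U"
      by (rule or_intro2) (use type in auto)
  qed
qed

section \<open>Minima of tails and the monotone subsequence\<close>

text \<open>
  The sequence \<open>f\<close>, restricted to the arguments beyond \<open>s\<close>, attains its minimum at \<open>t\<close>. The terms
  \<open>f\<close>, \<open>s\<close> and \<open>t\<close> must not contain the bound variable \<open>n\<close>.
\<close>

definition tail_min :: "tm \<Rightarrow> tm \<Rightarrow> tm \<Rightarrow> fm" where
  "tail_min f s t =
    (s \<^bold>< t \<^bold>\<and> (\<^bold>\<forall>(''n'', Nat). s \<^bold>< Var (''n'', Nat) \<^bold>\<longrightarrow> f \<^bold>\<cdot> t \<^bold>\<le> f \<^bold>\<cdot> Var (''n'', Nat)))"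

lemma tail_min_intro:
  "\<Gamma> \<tturnstile> s \<^bold>< t \<Longrightarrow>
    \<Gamma> \<tturnstile> (\<^bold>\<forall>(''n'', Nat). s \<^bold>< Var (''n'', Nat) \<^bold>\<longrightarrow> f \<^bold>\<cdot> t \<^bold>\<le> f \<^bold>\<cdot> Var (''n'', Nat)) \<Longrightarrow>
    \<Gamma> \<tturnstile> tail_min f s t"
  unfolding tail_min_def by (rule and_intro)

lemma tail_min_less: "\<Gamma> \<tturnstile> tail_min f s t \<Longrightarrow> \<Gamma> \<tturnstile> s \<^bold>< t"
  unfolding tail_min_def by (rule and_elim1)

lemma tail_min_le:
  "\<Gamma> \<tturnstile> tail_min f s t \<Longrightarrow>
    \<Gamma> \<tturnstile> (\<^bold>\<forall>(''n'', Nat). s \<^bold>< Var (''n'', Nat) \<^bold>\<longrightarrow> f \<^bold>\<cdot> t \<^bold>\<le> f \<^bold>\<cdot> Var (''n'', Nat))"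
  unfolding tail_min_def by (rule and_elim2)

text \<open>
  The induction is on \<open>v\<close>, for the statement that a minimum exists if \<open>\<alpha> k < v\<close> for some \<open>k > x\<close>.
  The bound is strict, so there is nothing to do for \<open>v = 0\<close>. In the step, LPO either yields
  \<open>n > x\<close> with \<open>\<alpha> n < \<alpha> k\<close>, hence \<open>\<alpha> n < v\<close>, or shows that \<open>k\<close> is a minimum.
\<close>

lemma tail_min_exists:
  defines "a \<equiv> Var (''a'', Nat \<^bold>\<Rightarrow> Nat)" and "x \<equiv> (''x'', Nat)" and "y \<equiv> (''y'', Nat)"
  shows "[LPO] \<tturnstile> (\<^bold>\<forall>x. \<^bold>\<exists>y. tail_min a (Var x) (Var y))"
proof -
  let ?n = "(''n'', Nat)" and ?k = "(''k'', Nat)" and ?v = "(''v'', Nat)"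
  let ?E = "\<^bold>\<exists>y. tail_min a (Var x) (Var y)"
  let ?C = "\<lambda>u. Var x \<^bold>< Var ?k \<^bold>\<longrightarrow> a \<^bold>\<cdot> Var ?k \<^bold>< u \<^bold>\<longrightarrow> ?E"
  let ?B = "\<lambda>u. \<^bold>\<forall>?k. ?C u"
  note defs = a_def x_def y_def tail_min_def
  have E: "wf_fm ?E" by (auto simp: defs)
  have "[LPO] \<tturnstile> (\<^bold>\<forall>?v. ?B (Var ?v))"
  proof (rule nat_induct_rule)
    have "[a \<^bold>\<cdot> Var ?k \<^bold>< Zero, Var x \<^bold>< Var ?k, LPO] \<tturnstile> ?E"
      by (rule bot_elim [OF not_less_Zero [OF hyp] E]) (auto simp: defs)
    then have "[LPO] \<tturnstile> ?B Zero"
      by (intro all_intro) (auto simp: seq_Cons)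
    then show "[LPO] \<tturnstile> subst (?B (Var ?v)) Zero ?v"
      by (simp add: defs)
  next
    let ?G = "[a \<^bold>\<cdot> Var ?k \<^bold>< Succ (Var ?v), Var x \<^bold>< Var ?k, ?B (Var ?v), LPO]"
    let ?s = "monus (Succ (Var x)) (Var ?n)" and ?t = "monus (Succ (a \<^bold>\<cdot> Var ?n)) (a \<^bold>\<cdot> Var ?k)"
    let ?P = "Var x \<^bold>< Var ?n \<^bold>\<and> a \<^bold>\<cdot> Var ?n \<^bold>< a \<^bold>\<cdot> Var ?k"
    let ?N = "Var x \<^bold>< Var ?n \<^bold>\<longrightarrow> a \<^bold>\<cdot> Var ?n \<^bold>< a \<^bold>\<cdot> Var ?k \<^bold>\<longrightarrow> \<^bold>\<bottom>"
    let ?X = "\<^bold>\<exists>?n. ?P" and ?U = "\<^bold>\<forall>?n. ?N"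
    have wf: "wf_ctxt ?G" "wf_fm ?X" "wf_fm ?U" "wf_fm ?P"
      by (auto simp: defs)
    \<comment> \<open>The equations \<open>?s = 0\<close> and \<open>?t = 0\<close> are by definition the two inequalities in \<open>?P\<close>.\<close>
    have "?G \<tturnstile> (\<^bold>\<exists>?n. ?s \<^bold>= Zero \<^bold>\<and> ?t \<^bold>= Zero)
        \<^bold>\<or> (\<^bold>\<forall>?n. ?s \<^bold>= Zero \<^bold>\<longrightarrow> ?t \<^bold>= Zero \<^bold>\<longrightarrow> \<^bold>\<bottom>)"
      by (rule LPO_decides [OF hyp]) (auto simp: defs)
    then have "?G \<tturnstile> ?X \<^bold>\<or> ?U"
      by (simp only: Less_def Le_def)
    then have "?G \<tturnstile> ?E"
    proof (rule or_elim)
      let ?G1 = "?P # ?X # ?G"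
      have wf1: "wf_ctxt ?G1" using wf by simp
      show "?X # ?G \<tturnstile> ?E"
      proof (rule ex_elim [OF hyp])
        have P: "?G1 \<tturnstile> ?P"
          by (rule hyp [OF _ wf1]) simp
        note and_elim2 [OF P]
        moreover have "?G1 \<tturnstile> a \<^bold>\<cdot> Var ?k \<^bold>\<le> Var ?v"
          unfolding less_Succ_iff [symmetric] by (rule hyp [OF _ wf1]) simp
        ultimately have an: "?G1 \<tturnstile> a \<^bold>\<cdot> Var ?n \<^bold>< Var ?v"
          by (rule less_le_trans)
        have "?G1 \<tturnstile> ?B (Var ?v)"
          by (rule hyp [OF _ wf1]) simp
        then have "?G1 \<tturnstile> Var x \<^bold>< Var ?n \<^bold>\<longrightarrow> a \<^bold>\<cdot> Var ?n \<^bold>< Var ?v \<^bold>\<longrightarrow> ?E"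
          by (rule all_elim [where t = "Var ?n"]) (auto simp: defs)
        from imp_elim [OF imp_elim [OF this and_elim1 [OF P]] an] show "?G1 \<tturnstile> ?E" .
      qed (use wf in \<open>auto simp: defs\<close>)
    next
      let ?G1 = "?U # ?G"
      have wf1: "wf_ctxt ?G1" using wf by simp
      have "?G1 \<tturnstile> (\<^bold>\<forall>?n. Var x \<^bold>< Var ?n \<^bold>\<longrightarrow> a \<^bold>\<cdot> Var ?k \<^bold>\<le> a \<^bold>\<cdot> Var ?n)"
      proof (rule all_intro, rule imp_intro)
        let ?G2 = "(Var x \<^bold>< Var ?n) # ?G1"
        have wf2: "wf_ctxt ?G2" using wf1 by (simp add: defs)
        show "?G2 \<tturnstile> a \<^bold>\<cdot> Var ?k \<^bold>\<le> a \<^bold>\<cdot> Var ?n"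
        proof (rule or_elim [OF le_or_less [OF wf2]])
          let ?L = "a \<^bold>\<cdot> Var ?k \<^bold>\<le> a \<^bold>\<cdot> Var ?n"
          show "?L # ?G2 \<tturnstile> ?L"
            by (rule hyp) (use wf2 in \<open>auto simp: defs\<close>)
          let ?G3 = "(a \<^bold>\<cdot> Var ?n \<^bold>< a \<^bold>\<cdot> Var ?k) # ?G2"
          have wf3: "wf_ctxt ?G3" using wf2 by (simp add: defs)
          have "?G3 \<tturnstile> ?U"
            by (rule hyp [OF _ wf3]) simp
          then have "?G3 \<tturnstile> ?N"
            by (rule all_elim [where t = "Var ?n"]) auto
          moreover have "?G3 \<tturnstile> Var x \<^bold>< Var ?n" "?G3 \<tturnstile> a \<^bold>\<cdot> Var ?n \<^bold>< a \<^bold>\<cdot> Var ?k"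
            by (rule hyp [OF _ wf3], simp)+
          ultimately have "?G3 \<tturnstile> \<^bold>\<bottom>"
            by (rule imp_elim [OF imp_elim])
          then show "?G3 \<tturnstile> ?L"
            by (rule bot_elim) (simp add: defs)
        qed (auto simp: defs)
      qed (auto simp: defs)
      moreover have "?G1 \<tturnstile> Var x \<^bold>< Var ?k"
        by (rule hyp [OF _ wf1]) simp
      ultimately have "?G1 \<tturnstile> tail_min a (Var x) (Var ?k)"
        by (rule tail_min_intro [rotated])
      then show "?G1 \<tturnstile> ?E"
        by (intro ex_intro [where t = "Var ?k"]) (auto simp: defs)
    qed
    then have "[?B (Var ?v), LPO] \<tturnstile> ?B (Succ (Var ?v))"
      by (intro all_intro) (auto simp: seq_Cons)
    then show "[?B (Var ?v), LPO] \<tturnstile> subst (?B (Var ?v)) (Succ (Var ?v)) ?v"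
      by (simp add: defs)
  qed auto
  \<comment> \<open>The search starts at \<open>k = x + 1\<close>, with the bound \<open>v = \<alpha> (x + 1) + 1\<close>.\<close>
  then have "[LPO] \<tturnstile> ?B (Succ (a \<^bold>\<cdot> Succ (Var x)))"
    by (rule all_elim) (auto simp: defs)
  then have "[LPO] \<tturnstile> Var x \<^bold>< Succ (Var x) \<^bold>\<longrightarrow>
      a \<^bold>\<cdot> Succ (Var x) \<^bold>< Succ (a \<^bold>\<cdot> Succ (Var x)) \<^bold>\<longrightarrow> ?E"
    by (rule all_elim [where t = "Succ (Var x)"]) (auto simp: defs)
  moreover have "[LPO] \<tturnstile> Var x \<^bold>< Succ (Var x)"
    "[LPO] \<tturnstile> a \<^bold>\<cdot> Succ (Var x) \<^bold>< Succ (a \<^bold>\<cdot> Succ (Var x))"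
    by (simp_all add: less_Succ_iff le_refl defs)
  ultimately have "[LPO] \<tturnstile> ?E"
    by (rule imp_elim [OF imp_elim])
  then show ?thesis
    by (rule all_intro) simp
qed

text \<open>
  Induction on \<open>n\<close>, with \<open>m\<close> fixed: \<open>m < n + 1\<close> leaves the cases \<open>m = n\<close> and \<open>m < n\<close>, and in both
  of them \<open>f n < f (n + 1)\<close> is the last step.
\<close>

lemma increasing_if_steps:
  defines "m \<equiv> (''m'', Nat)" and "n \<equiv> (''n'', Nat)"
  assumes step: "\<Gamma> \<tturnstile> (\<^bold>\<forall>m. f \<^bold>\<cdot> Var m \<^bold>< f \<^bold>\<cdot> Succ (Var m))"
    and type: "f \<^bold>: Nat \<^bold>\<Rightarrow> Nat" and f: "m \<notin> fv_tm f" "n \<notin> fv_tm f"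
    and fresh: "\<forall>B\<in>set \<Gamma>. m \<notin> fv B" "\<forall>B\<in>set \<Gamma>. n \<notin> fv B"
  shows "\<Gamma> \<tturnstile> (\<^bold>\<forall>m. \<^bold>\<forall>n. Var m \<^bold>< Var n \<^bold>\<longrightarrow> f \<^bold>\<cdot> Var m \<^bold>< f \<^bold>\<cdot> Var n)"
proof (rule all_intro, rule nat_induct_rule)
  let ?A = "\<lambda>u. Var m \<^bold>< u \<^bold>\<longrightarrow> f \<^bold>\<cdot> Var m \<^bold>< f \<^bold>\<cdot> u"
  note defs = m_def n_def
  have wf: "wf_ctxt \<Gamma>" by (rule seq_wf_ctxt [OF step])
  have "(Var m \<^bold>< Zero) # \<Gamma> \<tturnstile> f \<^bold>\<cdot> Var m \<^bold>< f \<^bold>\<cdot> Zero"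
    by (rule bot_elim [OF not_less_Zero [OF hyp]]) (use wf type in \<open>auto simp: defs\<close>)
  then show "\<Gamma> \<tturnstile> subst (?A (Var n)) Zero n"
    using f by (simp add: seq_Cons defs)
  let ?G = "(Var m \<^bold>< Succ (Var n)) # ?A (Var n) # \<Gamma>"
  have wfG: "wf_ctxt ?G" using wf type by (auto simp: defs)
  have "\<Gamma> \<tturnstile> f \<^bold>\<cdot> Var n \<^bold>< f \<^bold>\<cdot> Succ (Var n)"
    by (rule all_elim [OF step]) (use f in \<open>auto simp: defs\<close>)
  then have "?G \<tturnstile> f \<^bold>\<cdot> Var n \<^bold>< f \<^bold>\<cdot> Succ (Var n)"
    by (rule seq_weaken [OF seq_weaken]) (use wfG in auto)
  then have last: "B # ?G \<tturnstile> f \<^bold>\<cdot> Var n \<^bold>< f \<^bold>\<cdot> Succ (Var n)" if "wf_fm B" for B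
    using that by (rule seq_weaken)
  have "?G \<tturnstile> Var m \<^bold>< Succ (Var n)"
    by (rule hyp [OF _ wfG]) simp
  then have "?G \<tturnstile> Var m \<^bold>= Var n \<^bold>\<or> Var m \<^bold>< Var n"
    unfolding less_Succ_iff by (rule le_cases)
  then have "?G \<tturnstile> f \<^bold>\<cdot> Var m \<^bold>< f \<^bold>\<cdot> Succ (Var n)"
  proof (rule or_elim)
    let ?H = "(Var m \<^bold>= Var n) # ?G"
    have wfH: "wf_ctxt ?H" using wfG by (simp add: defs)
    have "?H \<tturnstile> f \<^bold>\<cdot> Var m \<^bold>= f \<^bold>\<cdot> Var n"
      by (rule app_cong_arg [OF hyp [OF _ wfH]]) (use type in \<open>auto simp: defs\<close>)
    moreover have "?H \<tturnstile> f \<^bold>\<cdot> Succ (Var n) \<^bold>= f \<^bold>\<cdot> Succ (Var n)"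
      by (rule eq_refl [OF _ wfH, where \<tau> = Nat]) (use type in \<open>auto simp: defs\<close>)
    ultimately show "?H \<tturnstile> f \<^bold>\<cdot> Var m \<^bold>< f \<^bold>\<cdot> Succ (Var n)"
      by (rule less_cong [OF last, rotated]) (simp add: defs)
  next
    let ?H = "(Var m \<^bold>< Var n) # ?G"
    have wfH: "wf_ctxt ?H" using wfG by (simp add: defs)
    have "?H \<tturnstile> f \<^bold>\<cdot> Var m \<^bold>< f \<^bold>\<cdot> Var n"
      by (rule imp_elim [OF hyp [OF _ wfH] hyp [OF _ wfH], of "Var m \<^bold>< Var n"]) simp_all
    from le_less_trans [OF less_imp_le [OF this] last]
    show "?H \<tturnstile> f \<^bold>\<cdot> Var m \<^bold>< f \<^bold>\<cdot> Succ (Var n)" by (simp add: defs)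
  qed
  then show "?A (Var n) # \<Gamma> \<tturnstile> subst (?A (Var n)) (Succ (Var n)) n"
    using f by (simp add: seq_Cons defs)
qed (use fresh in \<open>auto simp: n_def\<close>)

theorem proposition4p6: "{} \<^bold>\<turnstile> LPO \<^bold>\<longrightarrow> DL_1_inf"
proof -
  let ?a = "(''a'', Nat \<^bold>\<Rightarrow> Nat)" and ?i = "(''i'', Nat \<^bold>\<Rightarrow> Nat)" and ?f = "(''f'', Nat \<^bold>\<Rightarrow> Nat)"
  let ?m = "(''m'', Nat)" and ?n = "(''n'', Nat)" and ?k = "(''k'', Nat)"
  let ?x = "(''x'', Nat)" and ?y = "(''y'', Nat)"
  let ?A = "tail_min (Var ?a) (Var ?x) (Var ?y)"
  let ?T = "tail_min (Var ?a) (Var ?f \<^bold>\<cdot> Var ?m) (Var ?f \<^bold>\<cdot> Succ (Var ?m))"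
  let ?C = "Var ?f \<^bold>\<cdot> Zero \<^bold>= Zero \<^bold>\<and> (\<^bold>\<forall>?m. ?T)"
  let ?inc = "\<lambda>i. \<^bold>\<forall>?m. \<^bold>\<forall>?n. Var ?m \<^bold>< Var ?n \<^bold>\<longrightarrow> i \<^bold>\<cdot> Var ?m \<^bold>< i \<^bold>\<cdot> Var ?n"
  let ?mono = "\<lambda>i. \<^bold>\<forall>?m. \<^bold>\<forall>?n. Var ?m \<^bold>< Var ?n \<^bold>\<longrightarrow>
    Var ?a \<^bold>\<cdot> (i \<^bold>\<cdot> Var ?m) \<^bold>\<le> Var ?a \<^bold>\<cdot> (i \<^bold>\<cdot> Var ?n)"
  let ?D = "\<lambda>i. ?inc i \<^bold>\<and> ?mono i"
  note defs = tail_min_def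
  have "[LPO] \<tturnstile> (\<^bold>\<forall>?x. \<^bold>\<exists>?f. Var ?f \<^bold>\<cdot> Zero \<^bold>= Var ?x \<^bold>\<and>
      (\<^bold>\<forall>?m. subst (subst ?A (Var ?f \<^bold>\<cdot> Var ?m) ?x) (Var ?f \<^bold>\<cdot> Succ (Var ?m)) ?y))"
    by (rule dependent_choice [OF tail_min_exists]) (auto simp: defs)
  \<comment> \<open>The value \<open>f 0\<close> is arbitrary: only the values \<open>f (m + 1)\<close> will be positions of minima.\<close>
  then have "[LPO] \<tturnstile> (\<^bold>\<exists>?f. ?C)"
    by (rule all_elim [where t = Zero]) (auto simp: defs)
  then have "[LPO] \<tturnstile> (\<^bold>\<exists>?i. ?D (Var ?i))"
  proof (rule ex_elim)
    let ?G = "[?C, LPO]"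
    have wf: "wf_ctxt ?G" by (auto simp: defs)
    have "?G \<tturnstile> ?C"
      by (rule hyp [OF _ wf]) simp
    then have "?G \<tturnstile> (\<^bold>\<forall>?m. ?T)"
      by (rule and_elim2)
    then have T: "?G \<tturnstile> ?T"
      by (rule all_elim [where t = "Var ?m"]) auto
    have "?G \<tturnstile> Var ?f \<^bold>\<cdot> Var ?m \<^bold>< Var ?f \<^bold>\<cdot> Succ (Var ?m)"
      using T by (rule tail_min_less)
    then have "?G \<tturnstile> (\<^bold>\<forall>?m. Var ?f \<^bold>\<cdot> Var ?m \<^bold>< Var ?f \<^bold>\<cdot> Succ (Var ?m))"
      by (rule all_intro) (simp add: defs)
    then have f_inc: "?G \<tturnstile> ?inc (Var ?f)"
      by (rule increasing_if_steps) (auto simp: defs)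
    \<comment> \<open>The sequence of indices is \<open>m \<mapsto> f (m + 1)\<close>.\<close>
    let ?h = "Lam ?k (Var ?f \<^bold>\<cdot> Succ (Var ?k))"
    let ?H = "(Var ?m \<^bold>< Var ?n) # ?G"
    have wfH: "wf_ctxt ?H" using wf by simp
    have beta: "?H \<tturnstile> ?h \<^bold>\<cdot> t \<^bold>= Var ?f \<^bold>\<cdot> Succ t" if "t \<^bold>: Nat" for t
    proof -
      have "{} \<^bold>\<turnstile> ?h \<^bold>\<cdot> t \<^bold>= subst_tm (Var ?f \<^bold>\<cdot> Succ (Var ?k)) t ?k"
        by (rule Beta [where \<tau> = Nat]) (use that in auto)
      then show ?thesis using wfH by (simp add: seq_theorem)
    qed
    have mn: "?H \<tturnstile> Var ?m \<^bold>< Var ?n"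
      by (rule hyp [OF _ wfH]) simp
    have "?H \<tturnstile> ?h \<^bold>\<cdot> Var ?m \<^bold>< ?h \<^bold>\<cdot> Var ?n"
    proof (rule less_cong [OF imp_elim beta beta])
      have "?H \<tturnstile> ?inc (Var ?f)"
        using f_inc by (rule seq_weaken) simp
      then have "?H \<tturnstile> (\<^bold>\<forall>?n. Succ (Var ?m) \<^bold>< Var ?n \<^bold>\<longrightarrow>
          Var ?f \<^bold>\<cdot> Succ (Var ?m) \<^bold>< Var ?f \<^bold>\<cdot> Var ?n)"
        by (rule all_elim [where t = "Succ (Var ?m)"]) auto
      then show "?H \<tturnstile> Succ (Var ?m) \<^bold>< Succ (Var ?n) \<^bold>\<longrightarrow>
          Var ?f \<^bold>\<cdot> Succ (Var ?m) \<^bold>< Var ?f \<^bold>\<cdot> Succ (Var ?n)"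
        by (rule all_elim [where t = "Succ (Var ?n)"]) auto
      show "?H \<tturnstile> Succ (Var ?m) \<^bold>< Succ (Var ?n)"
        using mn by (simp add: Less_def Succ_le_Succ_iff)
    qed auto
    \<comment> \<open>\<open>f (m + 1)\<close> is a minimum beyond \<open>f m\<close>, and \<open>f m < f (n + 1)\<close>.\<close>
    moreover have "?H \<tturnstile> Var ?a \<^bold>\<cdot> (?h \<^bold>\<cdot> Var ?m) \<^bold>\<le> Var ?a \<^bold>\<cdot> (?h \<^bold>\<cdot> Var ?n)"
    proof (rule le_cong [OF imp_elim app_cong_arg [OF beta] app_cong_arg [OF beta]])
      have "?H \<tturnstile> (\<^bold>\<forall>?n. Var ?f \<^bold>\<cdot> Var ?m \<^bold>< Var ?n \<^bold>\<longrightarrow>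
          Var ?a \<^bold>\<cdot> (Var ?f \<^bold>\<cdot> Succ (Var ?m)) \<^bold>\<le> Var ?a \<^bold>\<cdot> Var ?n)"
        by (rule seq_weaken [OF tail_min_le [OF T]]) simp
      then show "?H \<tturnstile> Var ?f \<^bold>\<cdot> Var ?m \<^bold>< Var ?f \<^bold>\<cdot> Succ (Var ?n) \<^bold>\<longrightarrow>
          Var ?a \<^bold>\<cdot> (Var ?f \<^bold>\<cdot> Succ (Var ?m)) \<^bold>\<le> Var ?a \<^bold>\<cdot> (Var ?f \<^bold>\<cdot> Succ (Var ?n))"
        by (rule all_elim [where t = "Var ?f \<^bold>\<cdot> Succ (Var ?n)"]) auto
      show "?H \<tturnstile> Var ?f \<^bold>\<cdot> Var ?m \<^bold>< Var ?f \<^bold>\<cdot> Succ (Var ?n)"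
      proof (rule imp_elim)
        have "?H \<tturnstile> ?inc (Var ?f)"
          using f_inc by (rule seq_weaken) simp
        then have "?H \<tturnstile> (\<^bold>\<forall>?n. Var ?m \<^bold>< Var ?n \<^bold>\<longrightarrow> Var ?f \<^bold>\<cdot> Var ?m \<^bold>< Var ?f \<^bold>\<cdot> Var ?n)"
          by (rule all_elim [where t = "Var ?m"]) auto
        then show "?H \<tturnstile> Var ?m \<^bold>< Succ (Var ?n) \<^bold>\<longrightarrow>
            Var ?f \<^bold>\<cdot> Var ?m \<^bold>< Var ?f \<^bold>\<cdot> Succ (Var ?n)"
          by (rule all_elim [where t = "Succ (Var ?n)"]) auto
        show "?H \<tturnstile> Var ?m \<^bold>< Succ (Var ?n)"
          using mn by (simp add: less_Succ_iff less_imp_le)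
      qed
    qed auto
    ultimately have "?G \<tturnstile> ?D ?h"
      by (intro and_intro all_intro imp_intro) (auto simp: defs)
    then show "?G \<tturnstile> (\<^bold>\<exists>?i. ?D (Var ?i))"
      by (intro ex_intro [where t = ?h]) auto
  qed (auto simp: defs)
  then have "[LPO] \<tturnstile> DL_1_inf"
    unfolding DL_1_inf_def Let_def by (rule all_intro) simp
  then show ?thesis
    by (simp add: seq_Cons seq_Nil)
qed

end
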